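(* Let $1/2<\alpha\le1$, $0<\rho<\alpha-1/2$, $C_0>0$, $0<\varepsilon<1$, and let $\gamma>0$ be small enough, with $\gamma\ge\varepsilon^2/4$ and $x_{\varepsilon,\gamma}\le1$. There are a constant $C>0$ and a constant $M>0$ depending on $C_0$ such that the following holds for every $f:\mathbb{R}^2\to\mathbb{C}$ with $\|f\|_{C^{0,\alpha}(\mathbb{R}^2)}\le C_0$ and $\operatorname{supp}f\subset\{(x,y):y\ge x^2\}$. If $\|R[f]\|_{\varepsilon,\gamma}$ is sufficiently small, then for a suitable choice of the integer $N\ge1$ the mean $\mathcal{M}_{\varepsilon,\gamma}[f]=\mathcal{M}_{\varphi_N,\varepsilon,\gamma}[f]$ satisfies $$\sup_{|x|\le1/2}|\mathcal{M}_{\varepsilon,\gamma}[f](x)|\lesssim M\left(\frac{\log(C/\varepsilon)}{\log\left(M/\|R[f]\|_{\varepsilon,\gamma}\right)}\right)^{\rho}.$$ (The right-hand side is read as $0$ when $\|R[f]\|_{\varepsilon,\gamma}=0$.)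
   Context: Hölder seminorm: $\|f\|_{C^{0,\alpha}(\mathbb{R}^2)}=\sup_{p\ne q}|f(p)-f(q)|/\|p-q\|^\alpha$. Radon transform: $R[f](\xi,\eta)=\int_{\mathbb{R}}f(x,\xi x+\eta)\,dx$. Test functions: fix a sequence $\varphi_N\in C_0^\infty([-1,1])$, $N=1,2,\dots$, with $\varphi_N\ge0$, $\varphi_N$ even, $\int\varphi_N=1$, and $\|\varphi_N^{(k)}\|_\infty\le C_\ast^{k+1}N^k$ for $k\le N$, where $C_\ast$ does not depend on $N$ or $k$. Means: for a nonnegative even $\varphi\in C_0^\infty([-1,1])$ with $\int\varphi=1$ and $\varphi_{\varepsilon|x|}(t)=\frac1{\varepsilon|x|}\varphi\left(\frac{t}{\varepsilon|x|}\right)$, put $\mathcal{M}_{\varphi,\varepsilon,\gamma}[f](x)=\int f(x,y)\varphi_{\varepsilon|x|}(\gamma-y)\,dy$ for $x\ne0$ and $\mathcal{M}_{\varphi,\varepsilon,\gamma}[f](0)=f(0,\gamma)$. $x_{\varepsilon,\gamma}$ is the positive solution of $x^2=\varepsilon x+\gamma$; the condition $x_{\varepsilon,\gamma}\le1$ guarantees that $\mathcal{M}_{\varepsilon,\gamma}[f]$ is supported in $[-1,1]$. Data norm: $R_{\varepsilon,\gamma}=\{(\xi,\eta):|\xi|\le\varepsilon,|\eta|<\gamma\}$, and $\|\cdot\|_{\varepsilon,\gamma}$ is a fixed family of norms, increasing in $\varepsilon$ and $\gamma$, such that for some absolute constant $c>0$, $\|g\|_{\varepsilon,\gamma}\ge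 c\max\{\|g\|_{L^1(R_{\varepsilon,\gamma})},\|g(\cdot,\gamma)\|_{L^1[-\varepsilon,\varepsilon]}\}$; for example $\|g\|_{\varepsilon,\gamma}=\sup_{|\eta|\le\gamma}\|g(\cdot,\eta)\|_{L^1[-\varepsilon,\varepsilon]}$. $F\lesssim G$ means $F\le c\,G$ with a constant $c>0$ not depending on $f$, $\varepsilon$, $\gamma$ (it may depend on $\alpha$ and $\rho$). "Sufficiently small" means below a positive threshold not depending on $f$. *)

theory Defs
  imports "HOL-Analysis.Analysis"
begin

definition supp :: "('a::topological_space \<Rightarrow> 'b::zero) \<Rightarrow> 'a set" where
  "supp f = closure {x. f x \<noteq> 0}"

(* The seminorm takes the value infinity on functions that are not Hoelder continuous.
   On the type real * real, dist is the Euclidean distance. *)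
definition holder_seminorm ::
    "real \<Rightarrow> ('a::metric_space \<Rightarrow> 'b::real_normed_vector) \<Rightarrow> ennreal" where
  "holder_seminorm \<alpha> f =
     (SUP (p, q) \<in> {(p, q). p \<noteq> q}. ennreal (norm (f p - f q) / dist p q powr \<alpha>))"

definition radon :: "(real \<times> real \<Rightarrow> complex) \<Rightarrow> real \<times> real \<Rightarrow> complex" where
  "radon f = (\<lambda>(\<xi>, \<eta>). LINT x|lborel. f (x, \<xi> * x + \<eta>))"

definition smooth :: "(real \<Rightarrow> real) \<Rightarrow> bool" where
  "smooth g \<longleftrightarrow> (\<forall>k x. (deriv ^^ k) g field_differentiable at x)"

definition mean_kernel :: "(real \<Rightarrow> real) \<Rightarrow> bool" where
  "mean_kernel g \<longleftrightarrow> smooth g \<and> supp g \<subseteq> {-1..1} \<and> (\<forall>t. g t \<ge> 0) \<and>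
     (\<forall>t. g (- t) = g t) \<and> (LINT t|lborel. g t) = 1"

definition test_functions :: "(nat \<Rightarrow> real \<Rightarrow> real) \<Rightarrow> bool" where
  "test_functions \<phi> \<longleftrightarrow> (\<forall>N\<ge>1. mean_kernel (\<phi> N)) \<and>
     (\<exists>Cs. \<forall>N\<ge>1. \<forall>k\<le>N. \<forall>t. \<bar>(deriv ^^ k) (\<phi> N) t\<bar> \<le> Cs ^ (k + 1) * real N ^ k)"

definition mean ::
    "(real \<Rightarrow> real) \<Rightarrow> real \<Rightarrow> real \<Rightarrow> (real \<times> real \<Rightarrow> complex) \<Rightarrow> real \<Rightarrow> complex" where
  "mean g \<epsilon> \<gamma> f x =
     (if x = 0 then f (0, \<gamma>)
      else LINT y|lborel. f (x, y) * complex_of_real (g ((\<gamma> - y) / (\<epsilon> * \<bar>x\<bar>)) / (\<epsilon> * \<bar>x\<bar>)))"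

definition x_pos :: "real \<Rightarrow> real \<Rightarrow> real" where
  "x_pos \<epsilon> \<gamma> = (THE x. x > 0 \<and> x\<^sup>2 = \<epsilon> * x + \<gamma>)"

lemma x_pos_eq:
  assumes "\<gamma> > 0"
  shows "x_pos \<epsilon> \<gamma> = (\<epsilon> + sqrt (\<epsilon>\<^sup>2 + 4 * \<gamma>)) / 2"
proof -
  define s where "s = sqrt (\<epsilon>\<^sup>2 + 4 * \<gamma>)"
  have s2: "s\<^sup>2 = \<epsilon>\<^sup>2 + 4 * \<gamma>" unfolding s_def using assms by simp
  have "\<bar>\<epsilon>\<bar> < s" unfolding s_def using assms by (intro real_less_rsqrt) simp
  then have s: "- s < \<epsilon>" "\<epsilon> < s" by auto
  have "x_pos \<epsilon> \<gamma> = (\<epsilon> + s) / 2"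
    unfolding x_pos_def
  proof (rule the_equality)
    show "(\<epsilon> + s) / 2 > 0 \<and> ((\<epsilon> + s) / 2)\<^sup>2 = \<epsilon> * ((\<epsilon> + s) / 2) + \<gamma>"
      using s s2 by (auto simp: power2_eq_square field_simps)
  next
    fix x assume x: "x > 0 \<and> x\<^sup>2 = \<epsilon> * x + \<gamma>"
    have "(2 * x - \<epsilon> - s) * (2 * x - \<epsilon> + s) = 4 * (x\<^sup>2 - \<epsilon> * x - \<gamma>) + (\<epsilon>\<^sup>2 + 4 * \<gamma> - s\<^sup>2)"
      by (simp add: power2_eq_square algebra_simps)
    also have "\<dots> = 0" using x s2 by simp
    finally show "x = (\<epsilon> + s) / 2" using x s by auto
  qed
  then show ?thesis by (simp add: s_def)
qed

definition param_box :: "real \<Rightarrow> real \<Rightarrow> (real \<times> real) set" where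
  "param_box \<epsilon> \<gamma> = {(\<xi>, \<eta>). \<bar>\<xi>\<bar> \<le> \<epsilon> \<and> \<bar>\<eta>\<bar> < \<gamma>}"

(* The norms are extended-valued and act on Borel functions; the normed space proper is
   {g. nrm \<epsilon> \<gamma> g < \<infinity>}.  Definiteness (modulo null sets of the box) follows from the lower
   bound.  The parameters are restricted to (0,1) x (0,1], the range in which the mean is
   used: for unbounded \<gamma> no absolute constant c exists for the standard example, the norm
   data_sup_norm below. *)
definition data_norms ::
    "(real \<Rightarrow> real \<Rightarrow> (real \<times> real \<Rightarrow> complex) \<Rightarrow> ennreal) \<Rightarrow> bool" where
  "data_norms nrm \<longleftrightarrow>
     (\<forall>\<epsilon> \<gamma>. 0 < \<epsilon> \<and> \<epsilon> < 1 \<and> 0 < \<gamma> \<and> \<gamma> \<le> 1 \<longrightarrow>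
        (\<forall>g\<in>borel_measurable borel. \<forall>h\<in>borel_measurable borel.
            nrm \<epsilon> \<gamma> (\<lambda>p. g p + h p) \<le> nrm \<epsilon> \<gamma> g + nrm \<epsilon> \<gamma> h) \<and>
        (\<forall>g\<in>borel_measurable borel. \<forall>a. nrm \<epsilon> \<gamma> (\<lambda>p. a * g p) = ennreal (cmod a) * nrm \<epsilon> \<gamma> g)) \<and>
     (\<forall>\<epsilon> \<epsilon>' \<gamma> \<gamma>'. 0 < \<epsilon> \<and> \<epsilon> \<le> \<epsilon>' \<and> \<epsilon>' < 1 \<and> 0 < \<gamma> \<and> \<gamma> \<le> \<gamma>' \<and> \<gamma>' \<le> 1 \<longrightarrow>
        (\<forall>g\<in>borel_measurable borel. nrm \<epsilon> \<gamma> g \<le> nrm \<epsilon>' \<gamma>' g)) \<and>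
     (\<exists>c>0. \<forall>\<epsilon> \<gamma>. 0 < \<epsilon> \<and> \<epsilon> < 1 \<and> 0 < \<gamma> \<and> \<gamma> \<le> 1 \<longrightarrow>
        (\<forall>g\<in>borel_measurable borel.
            nrm \<epsilon> \<gamma> g \<ge> ennreal c *
              max (\<integral>\<^sup>+p\<in>param_box \<epsilon> \<gamma>. ennreal (cmod (g p)) \<partial>lborel)
                  (\<integral>\<^sup>+\<xi>\<in>{-\<epsilon>..\<epsilon>}. ennreal (cmod (g (\<xi>, \<gamma>))) \<partial>lborel)))"

definition data_sup_norm :: "real \<Rightarrow> real \<Rightarrow> (real \<times> real \<Rightarrow> complex) \<Rightarrow> ennreal" where
  "data_sup_norm \<epsilon> \<gamma> g =
     (SUP \<eta>\<in>{-\<gamma>..\<gamma>}. \<integral>\<^sup>+\<xi>\<in>{-\<epsilon>..\<epsilon>}. ennreal (cmod (g (\<xi>, \<eta>))) \<partial>lborel)"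

lemma data_norms_data_sup_norm: "data_norms data_sup_norm"
proof -
  have meas [measurable]: "(\<lambda>\<xi>. g (\<xi>, \<eta>)) \<in> borel_measurable borel"
    if "g \<in> borel_measurable borel" for g :: "real \<times> real \<Rightarrow> complex" and \<eta> :: real
  proof -
    have "(\<lambda>\<xi>::real. (\<xi>, \<eta>)) \<in> borel_measurable borel"
      by (intro borel_measurable_continuous_onI continuous_intros)
    from measurable_compose[OF this that] show ?thesis .
  qed
  have tri: "data_sup_norm \<epsilon> \<gamma> (\<lambda>p. g p + h p) \<le> data_sup_norm \<epsilon> \<gamma> g + data_sup_norm \<epsilon> \<gamma> h"
    if [measurable]: "g \<in> borel_measurable borel" "h \<in> borel_measurable borel" for \<epsilon> \<gamma> g h
    unfolding data_sup_norm_def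
  proof (rule SUP_least)
    fix \<eta> assume \<eta>: "\<eta> \<in> {-\<gamma>..\<gamma>}"
    have "(\<integral>\<^sup>+\<xi>\<in>{-\<epsilon>..\<epsilon>}. ennreal (cmod (g (\<xi>, \<eta>) + h (\<xi>, \<eta>))) \<partial>lborel)
        \<le> (\<integral>\<^sup>+\<xi>. ennreal (cmod (g (\<xi>, \<eta>))) * indicator {-\<epsilon>..\<epsilon>} \<xi>
              + ennreal (cmod (h (\<xi>, \<eta>))) * indicator {-\<epsilon>..\<epsilon>} \<xi> \<partial>lborel)"
      by (intro nn_integral_mono)
         (auto simp: indicator_def norm_triangle_ineq simp flip: ennreal_plus)
    also have "\<dots> = (\<integral>\<^sup>+\<xi>\<in>{-\<epsilon>..\<epsilon>}. ennreal (cmod (g (\<xi>, \<eta>))) \<partial>lborel)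
        + (\<integral>\<^sup>+\<xi>\<in>{-\<epsilon>..\<epsilon>}. ennreal (cmod (h (\<xi>, \<eta>))) \<partial>lborel)"
      by (rule nn_integral_add) measurable
    also have "\<dots> \<le> (SUP \<eta>\<in>{-\<gamma>..\<gamma>}. \<integral>\<^sup>+\<xi>\<in>{-\<epsilon>..\<epsilon>}. ennreal (cmod (g (\<xi>, \<eta>))) \<partial>lborel)
        + (SUP \<eta>\<in>{-\<gamma>..\<gamma>}. \<integral>\<^sup>+\<xi>\<in>{-\<epsilon>..\<epsilon>}. ennreal (cmod (h (\<xi>, \<eta>))) \<partial>lborel)"
      by (intro add_mono SUP_upper \<eta>)
    finally show "(\<integral>\<^sup>+\<xi>\<in>{-\<epsilon>..\<epsilon>}. ennreal (cmod (g (\<xi>, \<eta>) + h (\<xi>, \<eta>))) \<partial>lborel)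
        \<le> (SUP \<eta>\<in>{-\<gamma>..\<gamma>}. \<integral>\<^sup>+\<xi>\<in>{-\<epsilon>..\<epsilon>}. ennreal (cmod (g (\<xi>, \<eta>))) \<partial>lborel)
        + (SUP \<eta>\<in>{-\<gamma>..\<gamma>}. \<integral>\<^sup>+\<xi>\<in>{-\<epsilon>..\<epsilon>}. ennreal (cmod (h (\<xi>, \<eta>))) \<partial>lborel)" .
  qed
  have hom: "data_sup_norm \<epsilon> \<gamma> (\<lambda>p. a * g p) = ennreal (cmod a) * data_sup_norm \<epsilon> \<gamma> g"
    if [measurable]: "g \<in> borel_measurable borel" and "0 < \<gamma>" for \<epsilon> \<gamma> g a
    unfolding data_sup_norm_def
    by (simp add: norm_mult ennreal_mult mult.assoc nn_integral_cmult SUP_mult_left_ennreal)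
  have mono: "data_sup_norm \<epsilon> \<gamma> g \<le> data_sup_norm \<epsilon>' \<gamma>' g"
    if "\<epsilon> \<le> \<epsilon>'" "\<gamma> \<le> \<gamma>'" for \<epsilon> \<epsilon>' \<gamma> \<gamma>' g
    unfolding data_sup_norm_def using that
    by (intro SUP_mono' SUP_subset_mono nn_integral_mono mult_left_mono) (auto simp: indicator_def)
  have low: "data_sup_norm \<epsilon> \<gamma> g \<ge> ennreal (1/2) *
              max (\<integral>\<^sup>+p\<in>param_box \<epsilon> \<gamma>. ennreal (cmod (g p)) \<partial>lborel)
                  (\<integral>\<^sup>+\<xi>\<in>{-\<epsilon>..\<epsilon>}. ennreal (cmod (g (\<xi>, \<gamma>))) \<partial>lborel)"
    if [measurable]: "g \<in> borel_measurable borel" and \<gamma>: "0 < \<gamma>" "\<gamma> \<le> 1" for \<epsilon> \<gamma> g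
  proof -
    let ?S = "data_sup_norm \<epsilon> \<gamma> g"
    have le: "(\<integral>\<^sup>+\<xi>\<in>{-\<epsilon>..\<epsilon>}. ennreal (cmod (g (\<xi>, \<eta>))) \<partial>lborel) \<le> ?S" if "\<eta> \<in> {-\<gamma>..\<gamma>}" for \<eta>
      unfolding data_sup_norm_def using that by (rule SUP_upper)
    have box: "param_box \<epsilon> \<gamma> = {-\<epsilon>..\<epsilon>} \<times> {-\<gamma><..<\<gamma>}"
      by (auto simp: param_box_def)
    have [measurable]: "g \<in> borel_measurable (lborel \<Otimes>\<^sub>M lborel)"
      by (simp add: lborel_prod)
    have "(\<integral>\<^sup>+p\<in>param_box \<epsilon> \<gamma>. ennreal (cmod (g p)) \<partial>lborel)
        = (\<integral>\<^sup>+p. ennreal (cmod (g p)) * indicator ({-\<epsilon>..\<epsilon>} \<times> {-\<gamma><..<\<gamma>}) p \<partial>(lborel \<Otimes>\<^sub>M lborel))"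
      by (simp add: box lborel_prod)
    also have "\<dots> = (\<integral>\<^sup>+\<eta>. \<integral>\<^sup>+\<xi>. ennreal (cmod (g (\<xi>, \<eta>))) * indicator ({-\<epsilon>..\<epsilon>} \<times> {-\<gamma><..<\<gamma>}) (\<xi>, \<eta>)
          \<partial>lborel \<partial>lborel)"
      by (rule lborel_pair.nn_integral_snd[symmetric]) measurable
    also have "\<dots> \<le> (\<integral>\<^sup>+\<eta>. ?S * indicator {-\<gamma><..<\<gamma>} \<eta> \<partial>lborel)"
    proof (rule nn_integral_mono)
      fix \<eta> :: real
      have "(\<integral>\<^sup>+\<xi>. ennreal (cmod (g (\<xi>, \<eta>))) * indicator ({-\<epsilon>..\<epsilon>} \<times> {-\<gamma><..<\<gamma>}) (\<xi>, \<eta>) \<partial>lborel)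
          = (if \<eta> \<in> {-\<gamma><..<\<gamma>} then \<integral>\<^sup>+\<xi>\<in>{-\<epsilon>..\<epsilon>}. ennreal (cmod (g (\<xi>, \<eta>))) \<partial>lborel else 0)"
        by (simp add: indicator_times)
      also have "\<dots> \<le> ?S * indicator {-\<gamma><..<\<gamma>} \<eta>"
        using le[of \<eta>] by auto
      finally show "(\<integral>\<^sup>+\<xi>. ennreal (cmod (g (\<xi>, \<eta>))) * indicator ({-\<epsilon>..\<epsilon>} \<times> {-\<gamma><..<\<gamma>}) (\<xi>, \<eta>) \<partial>lborel)
          \<le> ?S * indicator {-\<gamma><..<\<gamma>} \<eta>" .
    qed
    also have "\<dots> = ?S * ennreal (2 * \<gamma>)"
      using \<gamma> by (simp add: nn_integral_cmult_indicator)
    also have "\<dots> \<le> ?S * 2"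
      using \<gamma> by (intro mult_left_mono) (auto simp flip: ennreal_numeral intro!: ennreal_leI)
    finally have 1: "(\<integral>\<^sup>+p\<in>param_box \<epsilon> \<gamma>. ennreal (cmod (g p)) \<partial>lborel) \<le> ?S * 2" .
    have "?S * 1 \<le> ?S * 2" by (intro mult_left_mono) auto
    then have 2: "(\<integral>\<^sup>+\<xi>\<in>{-\<epsilon>..\<epsilon>}. ennreal (cmod (g (\<xi>, \<gamma>))) \<partial>lborel) \<le> ?S * 2"
      using le[of \<gamma>] \<gamma> by (auto intro: order_trans)
    have "ennreal (1/2) * max (\<integral>\<^sup>+p\<in>param_box \<epsilon> \<gamma>. ennreal (cmod (g p)) \<partial>lborel)
                  (\<integral>\<^sup>+\<xi>\<in>{-\<epsilon>..\<epsilon>}. ennreal (cmod (g (\<xi>, \<gamma>))) \<partial>lborel) \<le> ennreal (1/2) * (?S * 2)"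
      by (intro mult_left_mono max.boundedI 1 2) auto
    also have "\<dots> = (ennreal (1/2) * ennreal 2) * ?S"
      by (simp add: ac_simps)
    also have "ennreal (1/2) * ennreal 2 = 1"
      by (subst ennreal_mult[symmetric]) auto
    finally show ?thesis by simp
  qed
  have low': "\<exists>c>0. \<forall>\<epsilon> \<gamma>. 0 < \<epsilon> \<and> \<epsilon> < 1 \<and> 0 < \<gamma> \<and> \<gamma> \<le> 1 \<longrightarrow>
        (\<forall>g\<in>borel_measurable borel.
            data_sup_norm \<epsilon> \<gamma> g \<ge> ennreal c *
              max (\<integral>\<^sup>+p\<in>param_box \<epsilon> \<gamma>. ennreal (cmod (g p)) \<partial>lborel)
                  (\<integral>\<^sup>+\<xi>\<in>{-\<epsilon>..\<epsilon>}. ennreal (cmod (g (\<xi>, \<gamma>))) \<partial>lborel))"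
    by (rule exI[of _ "1/2"]) (use low in auto)
  show ?thesis
    unfolding data_norms_def
    by (intro conjI low') (auto simp: tri hom intro: mono)
qed

end

theory Submission
  imports Defs
begin

text \<open>
  Write \<open>A\<close> for the mean of \<open>f\<close>.  The substitution \<open>y = \<gamma> + \<xi> x\<close> turns it into
  \<open>A(x) = \<integral> \<psi>(\<xi>) f(x, \<gamma> + \<xi> x) d\<xi>\<close> with \<open>\<psi>(\<xi>) = \<phi>\<^sub>N(\<xi>/\<epsilon>)/\<epsilon>\<close> (\<open>mean_eq_integral\<close>), so
  \<open>\<integral> A\<close> is a weighted integral of Radon data over the slopes \<open>|\<xi>| \<le> \<epsilon>\<close> at the offset \<open>\<gamma>\<close>.
  Higher moments are accessible because, for a function of \<open>\<xi> x + \<eta>\<close>, one derivative in \<open>\<xi>\<close>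
  is \<open>x\<close> times one derivative in \<open>\<eta>\<close>.  Trading \<open>k\<close> integrations in \<open>\<eta>\<close> against \<open>k\<close>
  integrations by parts in \<open>\<xi>\<close> expresses \<open>\<integral> x\<^sup>k A(x) dx\<close> as the integral of the data over the box
  against \<open>(-1)\<^sup>k (\<gamma> - \<eta>) ^ (k - 1) / (k - 1)!\<close> times the derivative of \<open>\<psi>\<close> of order \<open>k\<close>
  (\<open>integral_moment_eq_radon\<close>).  The condition \<open>\<gamma> \<ge> \<epsilon>\<^sup>2/4\<close> enters here: lines with
  \<open>|\<xi>| \<le> \<epsilon>\<close> and \<open>\<eta> \<le> -\<gamma>\<close> do not meet the interior of the parabola, so only data from the box occur.
  The factorial absorbs the growth \<open>N\<^sup>k\<close> of the derivatives of the test functions, and the moments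
  of order at most \<open>N\<close> are bounded by the data norm \<open>\<delta>\<close> times a factor exponential in \<open>N\<close>.

  On the other side, \<open>A\<close> inherits the Hoelder exponent \<open>\<alpha>\<close> of \<open>f\<close> and vanishes outside \<open>[-1, 1]\<close>.
  Smoothing \<open>A\<close> at scale \<open>1/\<surd>n\<close> with the Landau kernel \<open>(1 - u\<^sup>2/4)\<^sup>n\<close> changes it by at most a
  multiple of \<open>n powr (-\<alpha>/2)\<close>, and the smoothed value is a combination of the moments of
  order at most \<open>2 n\<close> with coefficients exponential in \<open>n\<close> (\<open>holder_bound_from_moments\<close>).  With
  \<open>N = 2 n\<close> this gives
  \<open>|A(x)| \<lesssim> C\<^sub>0 n powr (-\<alpha>/2) + (C/\<epsilon>) ^ (2 n + 1) \<delta>\<close> (\<open>mean_le_of_derivative_bounds\<close>).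
  Taking \<open>n\<close> to be the integer part of an eighth of \<open>L = ln(M/\<delta>) / ln(C/\<epsilon>)\<close> makes the second term
  exponentially small in \<open>L\<close>, and the first is of order \<open>L powr (-\<alpha>/2)\<close>.  This is good enough since
  \<open>\<alpha> \<le> 1\<close> gives \<open>\<rho> < \<alpha> - 1/2 \<le> \<alpha>/2\<close>.  When \<open>\<delta> = 0\<close>, all moments of \<open>A\<close> vanish and \<open>A = 0\<close>.
\<close>

section \<open>Landau smoothing and moments\<close>

text \<open>
  The product of \<open>u\<close> and the power \<open>n + 1\<close> of \<open>1 - u\<^sup>2/4\<close> vanishes at
  \<open>u = \<plusminus>2\<close>, and its derivative is \<open>1 - (2 n + 3) u\<^sup>2/4\<close> times the kernel.  The kernel is centred at
  \<open>x\<close> so that no change of variables is needed when it is paired with a function.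
\<close>

lemma landau_kernel_second_moment:
  fixes x :: real
  shows "integral {x - 2..x + 2} (\<lambda>y. (y - x)\<^sup>2 * (1 - (y - x)\<^sup>2 / 4) ^ n)
         = 4 / (2 * n + 3) * integral {x - 2..x + 2} (\<lambda>y. (1 - (y - x)\<^sup>2 / 4) ^ n)"
proof -
  let ?K = "\<lambda>y. (1 - (y - x)\<^sup>2 / 4) ^ n"
  let ?I = "{x - 2..x + 2}"
  have int: "?K integrable_on ?I" "(\<lambda>y. (y - x)\<^sup>2 * ?K y) integrable_on ?I"
    by (auto intro!: integrable_continuous_real continuous_intros)
  have "((\<lambda>y. ?K y - (2 * n + 3) / 4 * ((y - x)\<^sup>2 * ?K y)) has_integral
          (x + 2 - x) * (1 - (x + 2 - x)\<^sup>2 / 4) ^ Suc n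
          - (x - 2 - x) * (1 - (x - 2 - x)\<^sup>2 / 4) ^ Suc n) ?I"
  proof (rule fundamental_theorem_of_calculus)
    fix y assume "y \<in> ?I"
    define q where "q = 1 - (y - x)\<^sup>2 / 4"
    have "((\<lambda>y. (y - x) * (1 - (y - x)\<^sup>2 / 4) ^ Suc n) has_real_derivative
            q ^ Suc n - (y - x) * (Suc n * q ^ n * ((y - x) / 2))) (at y within ?I)"
      unfolding q_def by (rule derivative_eq_intros refl | simp)+
    also have "q ^ Suc n - (y - x) * (Suc n * q ^ n * ((y - x) / 2))
        = q ^ n * (q - (n + 1) / 2 * (y - x)\<^sup>2)"
    proof -
      have "q ^ Suc n - d * (Suc n * q ^ n * (d / 2)) = q ^ n * (q - (n + 1) / 2 * d\<^sup>2)" for d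
        by (simp add: field_simps power2_eq_square)
      then show ?thesis .
    qed
    also have "\<dots> = ?K y - (2 * n + 3) / 4 * ((y - x)\<^sup>2 * ?K y)"
      by (simp add: q_def algebra_simps)
    finally have "((\<lambda>y. (y - x) * (1 - (y - x)\<^sup>2 / 4) ^ Suc n) has_real_derivative
            ?K y - (2 * n + 3) / 4 * ((y - x)\<^sup>2 * ?K y)) (at y within ?I)" .
    then show "((\<lambda>y. (y - x) * (1 - (y - x)\<^sup>2 / 4) ^ Suc n) has_vector_derivative
            ?K y - (2 * n + 3) / 4 * ((y - x)\<^sup>2 * ?K y)) (at y within ?I)"
      by (simp add: has_real_derivative_iff_has_vector_derivative)
  qed simp
  then have "integral ?I (\<lambda>y. ?K y - (2 * n + 3) / 4 * ((y - x)\<^sup>2 * ?K y)) = 0"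
    by (simp add: integral_unique)
  moreover have "integral ?I (\<lambda>y. ?K y - (2 * n + 3) / 4 * ((y - x)\<^sup>2 * ?K y))
      = integral ?I ?K - (2 * n + 3) / 4 * integral ?I (\<lambda>y. (y - x)\<^sup>2 * ?K y)"
    using int by (subst integral_diff) (auto intro!: integrable_on_mult_right)
  ultimately have *: "integral ?I ?K = (2 * n + 3) / 4 * integral ?I (\<lambda>y. (y - x)\<^sup>2 * ?K y)"
    by linarith
  have "J = 4 / (2 * n + 3) * Z" if "Z = (2 * n + 3) / 4 * J" for J Z :: real
  proof -
    have "2 * real n + 3 \<noteq> 0" by linarith
    then show ?thesis using that by (simp add: nonzero_eq_divide_eq mult.commute)
  qed
  from this[OF *] show ?thesis by simp
qed

text \<open>
  An exponentially small lower bound is good enough: the bounds on the moments lose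
  factors exponential in \<open>n\<close> anyway.
\<close>

lemma landau_kernel_mass:
  fixes x :: real
  shows "2 * (3 / 4) ^ n \<le> integral {x - 2..x + 2} (\<lambda>y. (1 - (y - x)\<^sup>2 / 4) ^ n)"
proof -
  let ?K = "\<lambda>y. (1 - (y - x)\<^sup>2 / 4) ^ n"
  have sq: "(y - x)\<^sup>2 \<le> r\<^sup>2" if "y \<in> {x - r..x + r}" for y r :: real
    using that by (intro abs_le_square_iff[THEN iffD1]) auto
  have "2 * (3 / 4) ^ n = integral {x - 1..x + 1} (\<lambda>_. (3 / 4 :: real) ^ n)"
    by simp
  also have "\<dots> \<le> integral {x - 1..x + 1} ?K"
  proof (rule integral_le)
    fix y assume "y \<in> {x - 1..x + 1}"
    from sq[OF this] show "(3 / 4) ^ n \<le> ?K y"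
      by (intro power_mono) auto
  qed (auto intro!: integrable_continuous_real continuous_intros)
  also have "\<dots> \<le> integral {x - 2..x + 2} ?K"
    by (rule integral_subset_le)
       (use sq[where r = 2] in \<open>auto intro!: integrable_continuous_real continuous_intros\<close>)
  finally show ?thesis .
qed

text \<open>
  Expanded in powers of \<open>y\<close>, the kernel has coefficients whose absolute values sum to at most its
  value with all signs made positive, \<open>1 + (1 + |x|)\<^sup>2/4 \<le> 2\<close> to the power \<open>n\<close>.
\<close>

lemma landau_kernel_pairing_le:
  fixes A :: "real \<Rightarrow> complex"
  assumes cont: "continuous_on {-1..1} A" and x: "\<bar>x\<bar> \<le> 1"
    and mom: "\<And>k. k \<le> 2 * n \<Longrightarrow> norm (integral {-1..1} (\<lambda>y. y ^ k *\<^sub>R A y)) \<le> \<mu>"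
  shows "norm (integral {-1..1} (\<lambda>y. (1 - (y - x)\<^sup>2 / 4) ^ n *\<^sub>R A y)) \<le> 2 ^ n * \<mu>"
proof -
  define c where "c j i = real (n choose j) * (- 1 / 4) ^ j * (real (2 * j choose i) * (- x) ^ (2 * j - i))"
    for j i
  have \<mu>: "0 \<le> \<mu>" using order_trans[OF norm_ge_zero mom[of 0]] by simp
  have ex: "(1 - (y - x)\<^sup>2 / 4) ^ n = (\<Sum>j\<le>n. \<Sum>i\<le>2*j. c j i * y ^ i)" for y
  proof -
    have "(1 - (y - x)\<^sup>2 / 4) ^ n = ((- 1 / 4) * (y - x)\<^sup>2 + 1) ^ n" by simp
    also have "\<dots> = (\<Sum>j\<le>n. real (n choose j) * ((- 1 / 4) * (y - x)\<^sup>2) ^ j)"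
      by (subst binomial_ring) simp
    also have "\<dots> = (\<Sum>j\<le>n. real (n choose j) * (- 1 / 4) ^ j * (y + - x) ^ (2 * j))"
      by (simp only: power_mult_distrib power_mult[symmetric] mult.assoc) simp
    also have "\<dots> = (\<Sum>j\<le>n. \<Sum>i\<le>2*j. c j i * y ^ i)"
      by (subst binomial_ring) (simp add: c_def sum_distrib_left mult_ac)
    finally show ?thesis .
  qed
  have int: "(\<lambda>y. y ^ k *\<^sub>R A y) integrable_on {-1..1}" for k
    by (intro integrable_continuous_real continuous_intros cont)
  have "integral {-1..1} (\<lambda>y. (1 - (y - x)\<^sup>2 / 4) ^ n *\<^sub>R A y)
      = integral {-1..1} (\<lambda>y. \<Sum>j\<le>n. \<Sum>i\<le>2*j. c j i *\<^sub>R (y ^ i *\<^sub>R A y))"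
    by (simp add: ex scaleR_sum_left)
  also have "\<dots> = (\<Sum>j\<le>n. \<Sum>i\<le>2*j. c j i *\<^sub>R integral {-1..1} (\<lambda>y. y ^ i *\<^sub>R A y))"
    using int by (simp add: integral_sum integrable_sum integrable_cmul del: scaleR_scaleR)
  also have "norm \<dots> \<le> (\<Sum>j\<le>n. \<Sum>i\<le>2*j. \<bar>c j i\<bar> * \<mu>)"
    by (intro sum_norm_le) (auto intro!: mult_left_mono mom)
  also have "\<dots> = (\<Sum>j\<le>n. real (n choose j) * (1 / 4) ^ j * (\<bar>x\<bar> + 1) ^ (2 * j)) * \<mu>"
  proof -
    have "(\<Sum>i\<le>2*j. \<bar>c j i\<bar>) = real (n choose j) * (1 / 4) ^ j * (1 + \<bar>x\<bar>) ^ (2 * j)" for j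
      by (subst binomial_ring) (simp add: c_def sum_distrib_left abs_mult power_abs mult_ac)
    then show ?thesis by (simp add: sum_distrib_right[symmetric] add.commute)
  qed
  also have "(\<Sum>j\<le>n. real (n choose j) * (1 / 4) ^ j * (\<bar>x\<bar> + 1) ^ (2 * j))
      = ((1 / 4) * (\<bar>x\<bar> + 1)\<^sup>2 + 1) ^ n"
    by (subst binomial_ring[of "(1 / 4) * (\<bar>x\<bar> + 1)\<^sup>2"])
       (simp only: power_mult_distrib power_mult[symmetric] mult.assoc power_one mult_1_right)
  also have "\<dots> \<le> 2 ^ n"
  proof (intro power_mono)
    have "(\<bar>x\<bar> + 1)\<^sup>2 \<le> 2\<^sup>2" using x by (intro power_mono) auto
    then show "(1 / 4) * (\<bar>x\<bar> + 1)\<^sup>2 + 1 \<le> 2" by simp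
  qed simp
  finally show ?thesis using \<mu> by (simp add: mult_right_mono)
qed

text \<open>
  Replaces the fractional power by a quadratic one, so that the second moment of the kernel is
  all that is needed to bound the smoothing error.
\<close>

lemma powr_le_scaled_quadratic:
  fixes u \<alpha> :: real
  assumes "0 < \<alpha>" "\<alpha> \<le> 2" "0 < n"
  shows "\<bar>u\<bar> powr \<alpha> \<le> n powr (-\<alpha>/2) * (1 + n * u\<^sup>2)"
proof (cases "u = 0")
  case False
  define v where "v = n * u\<^sup>2"
  have v: "v > 0" using False assms by (simp add: v_def)
  have "\<bar>u\<bar> powr \<alpha> = (\<bar>u\<bar> powr 2) powr (\<alpha>/2)"
    unfolding powr_powr by simp
  also have "\<dots> = (v / n) powr (\<alpha>/2)" using False assms by (simp add: v_def)
  also have "\<dots> = n powr (-\<alpha>/2) * v powr (\<alpha>/2)"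
    using assms v by (simp add: powr_divide powr_minus_divide)
  also have "v powr (\<alpha>/2) \<le> 1 + v"
  proof (cases "v \<le> 1")
    case True
    then have "v powr (\<alpha>/2) \<le> 1" using assms v by (intro powr_le1) auto
    then show ?thesis using v by simp
  next
    case False
    then have "v powr (\<alpha>/2) \<le> v powr 1" using assms by (intro powr_mono) auto
    then show ?thesis using v by simp
  qed
  finally show ?thesis using assms by (simp add: v_def mult_left_mono)
qed (use assms in simp)

text \<open>
  A Hoelder function with small moments is small: the average of \<open>A\<close> against the normalised kernel is
  controlled by the moments, and it differs from \<open>A(x)\<close> by at most the Hoelder constant times the
  average of \<open>|x - y| powr \<alpha>\<close>, where the kernel concentrates at distance \<open>1/\<surd>n\<close> from \<open>x\<close>.
\<close>

lemma holder_bound_from_moments: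
  fixes A :: "real \<Rightarrow> complex"
  assumes hol: "\<And>x y. norm (A x - A y) \<le> H * \<bar>x - y\<bar> powr \<alpha>"
    and \<alpha>: "0 < \<alpha>" "\<alpha> \<le> 2" and n: "n > 0"
    and supp: "\<And>x. \<bar>x\<bar> \<ge> 1 \<Longrightarrow> A x = 0"
    and cont: "continuous_on UNIV A"
    and mom: "\<And>k. k \<le> 2 * n \<Longrightarrow> norm (integral {-1..1} (\<lambda>y. y ^ k *\<^sub>R A y)) \<le> \<mu>"
    and x: "\<bar>x\<bar> \<le> 1"
  shows "norm (A x) \<le> 3 * H * real n powr (-\<alpha>/2) + 3 ^ n * \<mu>"
proof -
  let ?I = "{x - 2..x + 2}"
  let ?K = "\<lambda>y. (1 - (y - x)\<^sup>2 / 4) ^ n"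
  define Z where "Z = integral ?I ?K"
  have Z: "2 * (3 / 4) ^ n \<le> Z" unfolding Z_def by (rule landau_kernel_mass)
  have Z0: "Z > 0" using less_le_trans[OF _ Z] by simp
  have \<mu>: "0 \<le> \<mu>" using order_trans[OF norm_ge_zero mom[of 0]] by simp
  have H: "0 \<le> H" using order_trans[OF norm_ge_zero hol[of 0 1]] by simp
  have K: "0 \<le> ?K y" if "y \<in> ?I" for y
  proof -
    have "(y - x)\<^sup>2 \<le> 2\<^sup>2" using that by (intro abs_le_square_iff[THEN iffD1]) auto
    then show ?thesis by simp
  qed
  have cA: "continuous_on S A" for S using cont continuous_on_subset by blast
  define E where "E = integral ?I (\<lambda>y. ?K y *\<^sub>R (A x - A y))"
  have "E = integral ?I (\<lambda>y. ?K y *\<^sub>R A x) - integral ?I (\<lambda>y. ?K y *\<^sub>R A y)"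
    unfolding E_def scaleR_diff_right
    by (intro integral_diff integrable_continuous_real)
       (auto intro!: continuous_intros cA)
  also have "integral ?I (\<lambda>y. ?K y *\<^sub>R A x) = Z *\<^sub>R A x"
    unfolding Z_def by (intro integral_unique has_integral_scaleR_left integrable_integral
      integrable_continuous_real) (auto intro!: continuous_intros)
  also have "integral ?I (\<lambda>y. ?K y *\<^sub>R A y) = integral {-1..1} (\<lambda>y. ?K y *\<^sub>R A y)"
    by (rule integral_spike_set; rule negligible_subset[of "{}"])
       (use x supp in \<open>auto simp: abs_le_iff\<close>)
  finally have "Z *\<^sub>R A x = E + integral {-1..1} (\<lambda>y. ?K y *\<^sub>R A y)" by simp
  then have "norm (Z *\<^sub>R A x) \<le> norm E + norm (integral {-1..1} (\<lambda>y. ?K y *\<^sub>R A y))"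
    by (metis norm_triangle_ineq)
  moreover have "norm (integral {-1..1} (\<lambda>y. ?K y *\<^sub>R A y)) \<le> 2 ^ n * \<mu>"
    by (rule landau_kernel_pairing_le[OF cA x mom])
  moreover have "norm E \<le> 3 * H * n powr (-\<alpha>/2) * Z"
  proof -
    let ?c = "H * real n powr (-\<alpha>/2)"
    have "norm E \<le> integral ?I (\<lambda>y. ?c * ?K y + ?c * n * ((y - x)\<^sup>2 * ?K y))"
      unfolding E_def
    proof (rule integral_norm_bound_integral)
      fix y assume y: "y \<in> ?I"
      have "norm (?K y *\<^sub>R (A x - A y)) \<le> ?K y * (H * \<bar>x - y\<bar> powr \<alpha>)"
        using K[OF y] hol[of x y] by (simp add: mult_left_mono)
      also have "\<dots> \<le> ?K y * (H * (n powr (-\<alpha>/2) * (1 + n * (x - y)\<^sup>2)))"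
        using K[OF y] H \<alpha> n by (intro mult_left_mono powr_le_scaled_quadratic) auto
      also have "\<dots> = ?c * ?K y + ?c * n * ((y - x)\<^sup>2 * ?K y)"
        by (simp add: algebra_simps power2_commute)
      finally show "norm (?K y *\<^sub>R (A x - A y)) \<le> ?c * ?K y + ?c * n * ((y - x)\<^sup>2 * ?K y)" .
    qed (auto intro!: integrable_continuous_real continuous_intros cA)
    also have "\<dots> = ?c * Z + ?c * n * (4 / (2 * n + 3) * Z)"
      by (subst integral_add)
         (auto intro!: integrable_continuous_real continuous_intros
            simp: landau_kernel_second_moment Z_def)
    also have "\<dots> = ?c * Z * (1 + 4 * n / (2 * n + 3))"
      by (simp add: field_simps)
    also have "\<dots> \<le> ?c * Z * 3"
      using H Z0 by (intro mult_left_mono) (auto simp: field_simps)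
    finally show ?thesis by (simp add: mult_ac)
  qed
  ultimately have "Z * norm (A x) \<le> 3 * H * n powr (-\<alpha>/2) * Z + 2 ^ n * \<mu>"
    using Z0 by simp
  also have "2 ^ n * \<mu> \<le> (3 ^ n * \<mu>) * Z"
  proof -
    have "(2::real) ^ n \<le> 3 ^ n * (2 * (3 / 4) ^ n)"
    proof -
      have "(2::real) ^ n \<le> (9/4) ^ n" by (intro power_mono) auto
      also have "\<dots> = 3 ^ n * (3 / 4) ^ n" by (simp add: power_mult_distrib[symmetric])
      also have "\<dots> \<le> 3 ^ n * (2 * (3 / 4) ^ n)" by simp
      finally show ?thesis .
    qed
    also have "\<dots> \<le> 3 ^ n * Z" using Z by simp
    finally have "2 ^ n * \<mu> \<le> 3 ^ n * Z * \<mu>" using \<mu> by (rule mult_right_mono)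
    then show ?thesis by (simp add: mult_ac)
  qed
  finally have "Z * norm (A x) \<le> Z * (3 * H * n powr (-\<alpha>/2) + 3 ^ n * \<mu>)"
    by (simp add: algebra_simps)
  then show ?thesis using Z0 by simp
qed

section \<open>Trading integrations in the offset for derivatives in the slope\<close>

text \<open>
  An antiderivative of a function vanishing on \<open>(-\<infinity>, b]\<close> is constant there; subtract the constant.
\<close>

lemma ex_antiderivative_vanishing_left:
  fixes h :: "real \<Rightarrow> complex"
  assumes "continuous_on UNIV h" and van: "\<And>y. y \<le> b \<Longrightarrow> h y = 0"
  obtains G where "\<And>y. (G has_vector_derivative h y) (at y)" "\<And>y. y \<le> b \<Longrightarrow> G y = 0"
proof -
  have "\<exists>G. \<forall>y::real. -\<infinity> < ereal y \<longrightarrow> ereal y < \<infinity> \<longrightarrow> (G has_vector_derivative h y) (at y)"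
    using assms(1) by (intro einterval_antiderivative) (auto simp: continuous_on_eq_continuous_at)
  then obtain G where G: "\<And>y. (G has_vector_derivative h y) (at y)" by auto
  show thesis
  proof (rule that[of "\<lambda>y. G y - G b"])
    show "((\<lambda>y. G y - G b) has_vector_derivative h y) (at y)" for y
      using G by (auto intro!: derivative_eq_intros)
    fix y assume y: "y \<le> b"
    have "(G has_vector_derivative 0) (at t within {..b})" if "t \<in> {..b}" for t
      using G[of t] van[of t] that by (auto intro: has_vector_derivative_at_within)
    then obtain c where "\<And>t. t \<in> {..b} \<Longrightarrow> G t = c"
      using has_vector_derivative_zero_constant[of "{..b}" G] by auto
    then show "G y - G b = 0" using y by simp
  qed
qed

text \<open>
  The normalisation at the left end removes all boundary terms from the Cauchy formula below.
\<close>

lemma iterated_antiderivatives: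
  fixes h :: "real \<Rightarrow> complex"
  assumes "continuous_on UNIV h" and van: "\<And>y. y \<le> b \<Longrightarrow> h y = 0"
  obtains F where "F 0 = h" "\<And>m y. (F (Suc m) has_vector_derivative F m y) (at y)"
    "\<And>m y. y \<le> b \<Longrightarrow> F m y = 0"
proof -
  let ?P = "\<lambda>n G. (n = (0::nat) \<longrightarrow> G = h) \<and> continuous_on UNIV G \<and> (\<forall>y\<le>b. G y = 0)"
  let ?Q = "\<lambda>n G G'. \<forall>y. (G' has_vector_derivative G y) (at y)"
  have "\<exists>F. \<forall>n. ?P n (F n) \<and> ?Q n (F n) (F (Suc n))"
  proof (rule dependent_nat_choice)
    show "\<exists>G. ?P 0 G" using assms by auto
  next
    fix G n assume "?P n G"
    then obtain G' where "\<And>y. (G' has_vector_derivative G y) (at y)" "\<And>y. y \<le> b \<Longrightarrow> G' y = 0"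
      using ex_antiderivative_vanishing_left[of G b] by blast
    moreover from this have "continuous_on UNIV G'"
      by (auto simp: continuous_on_eq_continuous_at intro: has_vector_derivative_continuous)
    ultimately show "\<exists>G'. ?P (Suc n) G' \<and> ?Q n G G'" by auto
  qed
  then show thesis using that by blast
qed

text \<open>
  Cauchy's formula for repeated integration: Taylor's formula with integral remainder for \<open>F k\<close>, expanded
  at a point where all the antiderivatives vanish.
\<close>

lemma cauchy_repeated_integration:
  fixes F :: "nat \<Rightarrow> real \<Rightarrow> complex"
  assumes "\<And>m y. (F (Suc m) has_vector_derivative F m y) (at y)"
    and "\<And>m y. y \<le> b \<Longrightarrow> F m y = 0" and "k > 0" and "a \<le> c" "s + a \<le> b"
  shows "integral {a..c} (\<lambda>\<eta>. ((c - \<eta>) ^ (k - 1) / fact (k - 1)) *\<^sub>R F 0 (s + \<eta>)) = F k (s + c)"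
proof -
  have "((\<lambda>\<eta>. F (k - m) (s + \<eta>)) has_vector_derivative F (k - Suc m) (s + t)) (at t within {a..c})"
    if "m < k" for m t
  proof -
    have "k - m = Suc (k - Suc m)" using that by simp
    then have "(F (k - m) has_vector_derivative F (k - Suc m) (s + t)) (at (s + t))"
      using assms(1) by metis
    moreover have "((\<lambda>\<eta>. s + \<eta>) has_vector_derivative 1) (at t)"
      by (auto intro!: derivative_eq_intros)
    ultimately have "(F (k - m) \<circ> (\<lambda>\<eta>. s + \<eta>) has_vector_derivative 1 *\<^sub>R F (k - Suc m) (s + t)) (at t)"
      by (intro vector_diff_chain_at) auto
    then show ?thesis by (auto simp: o_def intro: has_vector_derivative_at_within)
  qed
  then have "F (k - 0) (s + c) = (\<Sum>i<k. ((c - a) ^ i / fact i) *\<^sub>R F (k - i) (s + a))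
      + integral {a..c} (\<lambda>\<eta>. ((c - \<eta>) ^ (k - 1) / fact (k - 1)) *\<^sub>R F (k - k) (s + \<eta>))"
    using assms by (intro Taylor_integral[where f = "\<lambda>\<eta>. F (k - 0) (s + \<eta>)"
       and Df = "\<lambda>m \<eta>. F (k - m) (s + \<eta>)"]) auto
  then show ?thesis using assms by simp
qed

text \<open>
  Differentiating \<open>F (k + 1) (c + \<xi> x)\<close> in \<open>\<xi>\<close> produces a factor \<open>x\<close>; the boundary terms vanish with \<open>D\<close>.
\<close>

lemma integrate_by_parts_along_line:
  fixes F :: "nat \<Rightarrow> real \<Rightarrow> complex" and D :: "nat \<Rightarrow> real \<Rightarrow> real"
  assumes F: "\<And>m y. (F (Suc m) has_vector_derivative F m y) (at y)" and F0: "continuous_on UNIV (F 0)"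
    and D: "\<And>m t. (D m has_real_derivative D (Suc m) t) (at t)"
    and D0: "\<And>m t. \<epsilon> \<le> \<bar>t\<bar> \<Longrightarrow> D m t = 0" and \<epsilon>: "0 < \<epsilon>"
  shows "integral {-\<epsilon>..\<epsilon>} (\<lambda>\<xi>. D k \<xi> *\<^sub>R F k (c + \<xi> * x))
       = (- x) ^ k *\<^sub>R integral {-\<epsilon>..\<epsilon>} (\<lambda>\<xi>. D 0 \<xi> *\<^sub>R F 0 (c + \<xi> * x))"
proof (induction k)
  case (Suc k)
  let ?I = "{-\<epsilon>..\<epsilon>}"
  have Dc: "continuous_on S (D m)" for S m
    using D by (meson DERIV_isCont continuous_at_imp_continuous_on)
  have Fc: "continuous_on S (F m)" for S m
  proof (cases m)
    case 0 then show ?thesis using F0 continuous_on_subset by blast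
  next
    case (Suc m') then show ?thesis
      using F by (metis has_vector_derivative_continuous continuous_at_imp_continuous_on)
  qed
  have Fx: "continuous_on S (\<lambda>\<xi>. F m (c + \<xi> * x))" for S m
    by (rule continuous_on_compose2[OF Fc[of UNIV]]) (auto intro!: continuous_intros)
  have "((\<lambda>\<xi>. D k \<xi> *\<^sub>R (x *\<^sub>R F k (c + \<xi> * x)) + D (Suc k) \<xi> *\<^sub>R F (Suc k) (c + \<xi> * x)) has_integral
      D k \<epsilon> *\<^sub>R F (Suc k) (c + \<epsilon> * x) - D k (- \<epsilon>) *\<^sub>R F (Suc k) (c + (- \<epsilon>) * x)) ?I"
  proof (rule fundamental_theorem_of_calculus)
    fix \<xi> assume "\<xi> \<in> ?I"
    have "((\<lambda>\<xi>. c + \<xi> * x) has_vector_derivative x) (at \<xi>)"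
      by (auto intro!: derivative_eq_intros)
    then have "(F (Suc k) \<circ> (\<lambda>\<xi>. c + \<xi> * x) has_vector_derivative x *\<^sub>R F k (c + \<xi> * x)) (at \<xi>)"
      using F by (intro vector_diff_chain_at) auto
    then have "((\<lambda>\<xi>. D k \<xi> *\<^sub>R F (Suc k) (c + \<xi> * x)) has_vector_derivative
        D k \<xi> *\<^sub>R (x *\<^sub>R F k (c + \<xi> * x)) + D (Suc k) \<xi> *\<^sub>R F (Suc k) (c + \<xi> * x)) (at \<xi>)"
      by (intro has_vector_derivative_scaleR D) (simp add: o_def)
    then show "((\<lambda>\<xi>. D k \<xi> *\<^sub>R F (Suc k) (c + \<xi> * x)) has_vector_derivative
        D k \<xi> *\<^sub>R (x *\<^sub>R F k (c + \<xi> * x)) + D (Suc k) \<xi> *\<^sub>R F (Suc k) (c + \<xi> * x)) (at \<xi> within ?I)"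
      by (rule has_vector_derivative_at_within)
  qed (use \<epsilon> in simp)
  then have "integral ?I (\<lambda>\<xi>. D k \<xi> *\<^sub>R (x *\<^sub>R F k (c + \<xi> * x)) + D (Suc k) \<xi> *\<^sub>R F (Suc k) (c + \<xi> * x)) = 0"
    using D0 \<epsilon> by (simp add: integral_unique)
  moreover have "integral ?I (\<lambda>\<xi>. D k \<xi> *\<^sub>R (x *\<^sub>R F k (c + \<xi> * x)) + D (Suc k) \<xi> *\<^sub>R F (Suc k) (c + \<xi> * x))
      = integral ?I (\<lambda>\<xi>. x *\<^sub>R (D k \<xi> *\<^sub>R F k (c + \<xi> * x)))
        + integral ?I (\<lambda>\<xi>. D (Suc k) \<xi> *\<^sub>R F (Suc k) (c + \<xi> * x))"
    unfolding scaleR_left_commute[of _ x] by (subst integral_add)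
       (auto intro!: integrable_continuous_real continuous_intros Dc Fx)
  ultimately have "integral ?I (\<lambda>\<xi>. D (Suc k) \<xi> *\<^sub>R F (Suc k) (c + \<xi> * x))
      = - (x *\<^sub>R integral ?I (\<lambda>\<xi>. D k \<xi> *\<^sub>R F k (c + \<xi> * x)))"
    by (simp only: integral_cmul) (simp add: add_eq_0_iff)
  then show ?case by (simp add: Suc.IH)
qed simp

text \<open>
  One slice of the moment identity: \<open>h\<close> will be \<open>f(x, _)\<close> for a fixed \<open>x\<close>, and \<open>D k\<close> the derivative of order
  \<open>k\<close> of the averaging density.  The \<open>\<eta>\<close>-integral reproduces the \<open>k\<close>-fold antiderivative of \<open>h\<close>, and
  integrating by parts in \<open>\<xi>\<close> brings back \<open>h\<close> together with \<open>x\<^sup>k\<close>.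
\<close>

lemma moment_kernel_identity:
  fixes h :: "real \<Rightarrow> complex" and D :: "nat \<Rightarrow> real \<Rightarrow> real"
  assumes h: "continuous_on UNIV h" and van: "\<And>y. y \<le> \<epsilon> * \<bar>x\<bar> - \<gamma> \<Longrightarrow> h y = 0"
    and D: "\<And>m t. (D m has_real_derivative D (Suc m) t) (at t)"
    and D0: "\<And>m t. \<epsilon> \<le> \<bar>t\<bar> \<Longrightarrow> D m t = 0" and \<epsilon>: "0 < \<epsilon>" and \<gamma>: "0 \<le> \<gamma>" and k: "k > 0"
  shows "x ^ k *\<^sub>R integral {-\<epsilon>..\<epsilon>} (\<lambda>\<xi>. D 0 \<xi> *\<^sub>R h (\<gamma> + \<xi> * x))
    = integral (cbox (-\<epsilon>, -\<gamma>) (\<epsilon>, \<gamma>))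
        (\<lambda>(\<xi>, \<eta>). ((- 1) ^ k * D k \<xi> * ((\<gamma> - \<eta>) ^ (k - 1) / fact (k - 1))) *\<^sub>R h (\<xi> * x + \<eta>))"
proof -
  obtain F where F: "F 0 = h" "\<And>m y. (F (Suc m) has_vector_derivative F m y) (at y)"
    "\<And>m y. y \<le> \<epsilon> * \<bar>x\<bar> - \<gamma> \<Longrightarrow> F m y = 0"
    using iterated_antiderivatives[OF h van] by metis
  have Dc: "continuous_on S (D m)" for S m
    using D by (meson DERIV_isCont continuous_at_imp_continuous_on)
  have "integral (cbox (-\<epsilon>, -\<gamma>) (\<epsilon>, \<gamma>))
        (\<lambda>(\<xi>, \<eta>). ((- 1) ^ k * D k \<xi> * ((\<gamma> - \<eta>) ^ (k - 1) / fact (k - 1))) *\<^sub>R h (\<xi> * x + \<eta>))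
    = integral {-\<epsilon>..\<epsilon>} (\<lambda>\<xi>. integral {-\<gamma>..\<gamma>}
        (\<lambda>\<eta>. ((- 1) ^ k * D k \<xi> * ((\<gamma> - \<eta>) ^ (k - 1) / fact (k - 1))) *\<^sub>R h (\<xi> * x + \<eta>)))"
    by (subst integral_prod_continuous)
       (auto simp: case_prod_unfold intro!: continuous_intros continuous_on_compose2[OF Dc[of UNIV]]
          continuous_on_compose2[OF h])
  also have "\<dots> = integral {-\<epsilon>..\<epsilon>} (\<lambda>\<xi>. (- 1) ^ k *\<^sub>R (D k \<xi> *\<^sub>R F k (\<gamma> + \<xi> * x)))"
  proof (rule integral_cong)
    fix \<xi> assume \<xi>: "\<xi> \<in> {-\<epsilon>..\<epsilon>}"
    have "\<bar>\<xi> * x\<bar> \<le> \<epsilon> * \<bar>x\<bar>"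
      using \<xi> by (auto simp: abs_mult intro!: mult_right_mono)
    then have *: "\<xi> * x + - \<gamma> \<le> \<epsilon> * \<bar>x\<bar> - \<gamma>" by linarith
    have "integral {-\<gamma>..\<gamma>} (\<lambda>\<eta>. ((\<gamma> - \<eta>) ^ (k - 1) / fact (k - 1)) *\<^sub>R F 0 (\<xi> * x + \<eta>))
        = F k (\<xi> * x + \<gamma>)"
      using \<gamma> by (intro cauchy_repeated_integration[where b = "\<epsilon> * \<bar>x\<bar> - \<gamma>"] F * k) auto
    then have "((- 1) ^ k * D k \<xi>) *\<^sub>R
        integral {-\<gamma>..\<gamma>} (\<lambda>\<eta>. ((\<gamma> - \<eta>) ^ (k - 1) / fact (k - 1)) *\<^sub>R h (\<xi> * x + \<eta>))
        = (- 1) ^ k *\<^sub>R (D k \<xi> *\<^sub>R F k (\<gamma> + \<xi> * x))"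
      by (simp add: F(1) add.commute)
    then show "integral {-\<gamma>..\<gamma>}
        (\<lambda>\<eta>. ((- 1) ^ k * D k \<xi> * ((\<gamma> - \<eta>) ^ (k - 1) / fact (k - 1))) *\<^sub>R h (\<xi> * x + \<eta>))
        = (- 1) ^ k *\<^sub>R (D k \<xi> *\<^sub>R F k (\<gamma> + \<xi> * x))"
      by (simp only: integral_cmul[symmetric] scaleR_scaleR)
  qed
  also have "\<dots> = (- 1) ^ k *\<^sub>R ((- x) ^ k *\<^sub>R
      integral {-\<epsilon>..\<epsilon>} (\<lambda>\<xi>. D 0 \<xi> *\<^sub>R F 0 (\<gamma> + \<xi> * x)))"
    unfolding integral_cmul
    using h by (subst integrate_by_parts_along_line[where F = F and D = D])
       (auto simp: F(1) intro: F(2) D D0 \<epsilon>)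
  also have "\<dots> = x ^ k *\<^sub>R integral {-\<epsilon>..\<epsilon>} (\<lambda>\<xi>. D 0 \<xi> *\<^sub>R h (\<gamma> + \<xi> * x))"
    by (simp add: F(1) power_mult_distrib[symmetric])
  finally show ?thesis ..
qed

section \<open>The Radon transform of functions supported above the parabola\<close>

lemma holder_seminorm_boundD:
  fixes f :: "'a::metric_space \<Rightarrow> 'b::real_normed_vector"
  assumes "holder_seminorm \<alpha> f \<le> ennreal C0" "0 \<le> C0"
  shows "norm (f p - f q) \<le> C0 * dist p q powr \<alpha>"
proof (cases "p = q")
  case False
  have "ennreal (norm (f p - f q) / dist p q powr \<alpha>) \<le> holder_seminorm \<alpha> f"
    unfolding holder_seminorm_def using False by (intro SUP_upper2[of "(p, q)"]) auto
  then have "norm (f p - f q) / dist p q powr \<alpha> \<le> C0"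
    using assms by (metis order_trans ennreal_le_iff)
  then show ?thesis using False by (simp add: field_simps)
qed simp

lemma continuous_if_holder_bound:
  fixes f :: "'a::metric_space \<Rightarrow> 'b::real_normed_vector"
  assumes "\<And>p q. norm (f p - f q) \<le> H * dist p q powr \<alpha>" "0 < \<alpha>"
  shows "continuous_on UNIV f"
  unfolding continuous_on_eq_continuous_at[OF open_UNIV]
proof
  fix p :: 'a
  have "((\<lambda>q. dist q p) \<longlongrightarrow> 0) (at p)"
    using tendsto_dist[OF tendsto_ident_at tendsto_const, of p p UNIV] by simp
  then have "((\<lambda>q. dist q p powr \<alpha>) \<longlongrightarrow> 0 powr \<alpha>) (at p)"
    by (rule tendsto_powr2) (use assms(2) in auto)
  from tendsto_mult_left[OF this, of H]
  have "((\<lambda>q. H * dist q p powr \<alpha>) \<longlongrightarrow> 0) (at p)" by simp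
  then have "((\<lambda>q. f q - f p) \<longlongrightarrow> 0) (at p)"
    by (rule Lim_null_comparison[rotated]) (intro always_eventually allI assms(1))
  then show "isCont f p" by (simp add: isCont_def LIM_zero_iff)
qed

text \<open>
  On the parabola itself the value is zero by continuity.
\<close>

lemma vanishes_below_parabola:
  fixes f :: "real \<times> real \<Rightarrow> complex"
  assumes "continuous_on UNIV f" "supp f \<subseteq> {(x, y). y \<ge> x\<^sup>2}" "y \<le> x\<^sup>2"
  shows "f (x, y) = 0"
proof -
  have 0: "f (x, t) = 0" if "t < x\<^sup>2" for t
  proof (rule ccontr)
    assume "f (x, t) \<noteq> 0"
    then have "(x, t) \<in> supp f"
      unfolding supp_def by (intro subsetD[OF closure_subset]) simp
    then show False using assms(2) that by auto
  qed
  have c: "continuous_on UNIV (\<lambda>t. f (x, t))"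
    by (rule continuous_on_compose2[OF assms(1)]) (auto intro!: continuous_intros)
  have "closed {t. f (x, t) = 0}"
    using closed_Collect_eq[OF c continuous_on_const] by simp
  moreover have "{..<x\<^sup>2} \<subseteq> {t. f (x, t) = 0}" using 0 by auto
  ultimately have "closure {..<x\<^sup>2} \<subseteq> {t. f (x, t) = 0}" by (rule closure_minimal[rotated])
  then show ?thesis using assms(3) by auto
qed

lemma radon_borel_measurable:
  assumes "continuous_on UNIV f"
  shows "radon f \<in> borel_measurable borel"
proof -
  have sets: "sets (borel \<Otimes>\<^sub>M lborel) = sets (borel :: ((real \<times> real) \<times> real) measure)"
    by (subst sets_pair_measure_cong[OF refl sets_lborel]) (simp only: borel_prod)
  have "(\<lambda>(p::real \<times> real, x). f (x, fst p * x + snd p)) \<in> borel_measurable borel"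
    unfolding case_prod_unfold
    by (intro borel_measurable_continuous_onI continuous_on_compose2[OF assms])
       (auto intro!: continuous_intros)
  then have "(\<lambda>(p::real \<times> real, x). f (x, fst p * x + snd p)) \<in> borel_measurable (borel \<Otimes>\<^sub>M lborel)"
    unfolding measurable_cong_sets[OF sets refl] .
  from lborel.borel_measurable_lebesgue_integral[OF this]
  show ?thesis by (simp add: radon_def case_prod_unfold)
qed

lemma lborel_integral_eq_integral_Icc:
  fixes g :: "real \<Rightarrow> 'b::euclidean_space"
  assumes "continuous_on {-a..a} g" and van: "\<And>x. \<bar>x\<bar> \<ge> a \<Longrightarrow> g x = 0"
  shows "(LINT x|lborel. g x) = integral {-a..a} g"
proof -
  have i: "set_integrable lborel {-a..a} g"
    using assms(1) by (rule borel_integrable_atLeastAtMost')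
  have "g x = indicator {-a..a} x *\<^sub>R g x" for x
  proof (cases "x \<in> {-a..a}")
    case False
    then have "\<bar>x\<bar> \<ge> a" by auto
    then show ?thesis using van by simp
  qed simp
  then have "(LINT x|lborel. g x) = (LINT x : {-a..a} | lborel. g x)"
    unfolding set_lebesgue_integral_def by (rule Bochner_Integration.integral_cong[OF refl])
  also have "\<dots> = integral {-a..a} g" by (rule set_borel_integral_eq_integral[OF i])
  finally show ?thesis .
qed

lemma radon_eq_integral:
  assumes f: "continuous_on UNIV f" and van: "\<And>x. \<bar>x\<bar> \<ge> 1 \<Longrightarrow> f (x, \<xi> * x + \<eta>) = 0"
  shows "radon f (\<xi>, \<eta>) = integral {-1..1} (\<lambda>x. f (x, \<xi> * x + \<eta>))"
proof -
  have "continuous_on {-1..1} (\<lambda>x. f (x, \<xi> * x + \<eta>))"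
    by (intro continuous_on_compose2[OF f]) (auto intro!: continuous_intros)
  then show ?thesis
    unfolding radon_def prod.case by (rule lborel_integral_eq_integral_Icc) (rule van)
qed

text \<open>
  Passes from Henstock-Kurzweil integrals over closed boxes to the Lebesgue integrals that bound the data
  norms from below; \<open>S\<close> may omit parts of the boundary of the box, as the parameter box does.
\<close>

lemma norm_integral_le_weight_times_L1:
  fixes g :: "'a::euclidean_space \<Rightarrow> complex" and w :: "'a \<Rightarrow> real"
  assumes g: "continuous_on (cbox a b) g" and w: "continuous_on (cbox a b) w"
    and W: "\<And>p. p \<in> cbox a b \<Longrightarrow> \<bar>w p\<bar> \<le> W" and "0 \<le> W" and S: "box a b \<subseteq> S"
  shows "ennreal (norm (integral (cbox a b) (\<lambda>p. w p *\<^sub>R g p)))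
       \<le> ennreal W * (\<integral>\<^sup>+p\<in>S. ennreal (norm (g p)) \<partial>lborel)"
proof -
  let ?J = "integral (cbox a b) (\<lambda>p. norm (g p))"
  have i: "(\<lambda>p. norm (g p)) integrable_on cbox a b"
    by (intro integrable_continuous continuous_intros g)
  have "norm (integral (cbox a b) (\<lambda>p. w p *\<^sub>R g p)) \<le> integral (cbox a b) (\<lambda>p. W * norm (g p))"
    by (intro integral_norm_bound_integral integrable_continuous continuous_intros g w)
       (auto intro!: mult_right_mono W)
  also have "\<dots> = W * ?J" by simp
  finally have "ennreal (norm (integral (cbox a b) (\<lambda>p. w p *\<^sub>R g p))) \<le> ennreal (W * ?J)"
    by (rule ennreal_leI)
  also have "\<dots> = ennreal W * ennreal ?J"
    using assms(4) by (rule ennreal_mult')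
  also have "ennreal ?J = (\<integral>\<^sup>+p\<in>box a b. ennreal (norm (g p)) \<partial>lborel)"
    using i by (intro nn_integral_has_integral_lebesgue'[symmetric])
       (auto simp: has_integral_open_interval integrable_integral)
  also have "ennreal W * \<dots> \<le> ennreal W * (\<integral>\<^sup>+p\<in>S. ennreal (norm (g p)) \<partial>lborel)"
    using S by (intro mult_left_mono nn_integral_mono) (auto simp: indicator_def)
  finally show ?thesis .
qed

section \<open>Moments as weighted integrals of Radon data\<close>

text \<open>
  Lines with offset at most \<open>\<gamma>\<close> and slope at most \<open>\<epsilon>\<close> in absolute value meet the interior of the parabola only over
  \<open>(-1, 1)\<close>: for \<open>|x| \<ge> 1\<close> the height is at most \<open>(\<epsilon> + \<gamma>) |x| \<le> x\<^sup>2\<close>.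
\<close>

lemma line_below_parabola_outside_interval:
  fixes x :: real
  assumes "\<bar>x\<bar> \<ge> 1" "\<bar>\<xi>\<bar> \<le> \<epsilon>" "\<eta> \<le> \<gamma>" "0 \<le> \<gamma>" "\<epsilon> + \<gamma> \<le> 1"
  shows "\<xi> * x + \<eta> \<le> x\<^sup>2"
proof -
  have "\<xi> * x + \<eta> \<le> \<bar>\<xi>\<bar> * \<bar>x\<bar> + \<gamma> * 1" using assms by (simp add: abs_mult[symmetric])
  also have "\<dots> \<le> \<epsilon> * \<bar>x\<bar> + \<gamma> * \<bar>x\<bar>"
    using assms by (intro add_mono mult_right_mono mult_left_mono) auto
  also have "\<dots> = (\<epsilon> + \<gamma>) * \<bar>x\<bar>" by (simp add: algebra_simps)
  also have "\<dots> \<le> \<bar>x\<bar> * \<bar>x\<bar>" using assms by (intro mult_right_mono) auto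
  finally show ?thesis by (simp add: power2_eq_square)
qed

text \<open>
  Integrate \<open>moment_kernel_identity\<close> over \<open>x\<close> and exchange the order of integration: the inner
  \<open>x\<close>-integral is then a Radon integral.
\<close>

lemma integral_moment_eq_radon:
  fixes f :: "real \<times> real \<Rightarrow> complex" and D :: "nat \<Rightarrow> real \<Rightarrow> real"
  assumes f: "continuous_on UNIV f" and par: "\<And>x y. y \<le> x\<^sup>2 \<Longrightarrow> f (x, y) = 0"
    and D: "\<And>m t. (D m has_real_derivative D (Suc m) t) (at t)"
    and D0: "\<And>m t. \<epsilon> \<le> \<bar>t\<bar> \<Longrightarrow> D m t = 0" and \<epsilon>: "0 < \<epsilon>" and \<gamma>: "0 \<le> \<gamma>"
    and g4: "\<epsilon>\<^sup>2 / 4 \<le> \<gamma>" and eg: "\<epsilon> + \<gamma> \<le> 1" and k: "k > 0"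
  defines "A \<equiv> \<lambda>x. integral {-\<epsilon>..\<epsilon>} (\<lambda>\<xi>. D 0 \<xi> *\<^sub>R f (x, \<gamma> + \<xi> * x))"
  shows "integral {-1..1} (\<lambda>x. x ^ k *\<^sub>R A x) = integral (cbox (-\<epsilon>, -\<gamma>) (\<epsilon>, \<gamma>))
       (\<lambda>p. ((- 1) ^ k * D k (fst p) * ((\<gamma> - snd p) ^ (k - 1) / fact (k - 1))) *\<^sub>R radon f p)"
proof -
  let ?B = "cbox (-\<epsilon>, -\<gamma>) (\<epsilon>, \<gamma>)"
  define W where "W p = (- 1) ^ k * D k (fst p) * ((\<gamma> - snd p) ^ (k - 1) / fact (k - 1))" for p :: "real \<times> real"
  have Dc: "continuous_on S (D m)" for S m
    using D by (meson DERIV_isCont continuous_at_imp_continuous_on)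
  have Wc: "continuous_on S W" for S
    unfolding W_def by (intro continuous_intros continuous_on_compose2[OF Dc[of UNIV]]) auto
  have "x ^ k *\<^sub>R A x = integral ?B (\<lambda>p. W p *\<^sub>R f (x, fst p * x + snd p))" for x
  proof -
    have "continuous_on UNIV (\<lambda>y. f (x, y))"
      by (intro continuous_on_compose2[OF f] continuous_intros) auto
    moreover have "f (x, y) = 0" if "y \<le> \<epsilon> * \<bar>x\<bar> - \<gamma>" for y
    proof (rule par)
      have "0 \<le> (\<bar>x\<bar> - \<epsilon> / 2)\<^sup>2" by simp
      also have "\<dots> = x\<^sup>2 - \<epsilon> * \<bar>x\<bar> + \<epsilon>\<^sup>2 / 4"
        by (simp add: power2_diff power_divide mult.commute)
      finally show "y \<le> x\<^sup>2" using that g4 by linarith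
    qed
    ultimately show ?thesis
      unfolding A_def W_def case_prod_unfold[symmetric]
      by (subst moment_kernel_identity[of "\<lambda>y. f (x, y)" \<epsilon> x \<gamma> D k])
         (use D D0 \<epsilon> \<gamma> k in \<open>auto simp: case_prod_unfold\<close>)
  qed
  then have "integral {-1..1} (\<lambda>x. x ^ k *\<^sub>R A x)
      = integral (cbox (-1) 1) (\<lambda>x. integral ?B (\<lambda>p. W p *\<^sub>R f (x, fst p * x + snd p)))"
    by simp
  also have "\<dots> = integral ?B (\<lambda>p. integral (cbox (-1) 1) (\<lambda>x. W p *\<^sub>R f (x, fst p * x + snd p)))"
    unfolding case_prod_unfold
    by (intro integral_swap_continuous)
       (auto simp: case_prod_unfold intro!: continuous_on_scaleR continuous_on_compose2[OF Wc[of UNIV]]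
          continuous_on_compose2[OF f, of _ "\<lambda>q. (fst q, fst (snd q) * fst q + snd (snd q))"] continuous_intros)
  also have "\<dots> = integral ?B (\<lambda>p. W p *\<^sub>R radon f p)"
  proof (rule integral_cong)
    fix p assume "p \<in> ?B"
    then obtain \<xi> \<eta> where p: "p = (\<xi>, \<eta>)" "\<bar>\<xi>\<bar> \<le> \<epsilon>" "\<eta> \<le> \<gamma>" by (cases p) auto
    have "f (x, \<xi> * x + \<eta>) = 0" if "\<bar>x\<bar> \<ge> 1" for x
      using line_below_parabola_outside_interval[OF that p(2,3) \<gamma> eg] by (rule par)
    then show "integral (cbox (-1) 1) (\<lambda>x. W p *\<^sub>R f (x, fst p * x + snd p)) = W p *\<^sub>R radon f p"
      using radon_eq_integral[OF f] by (simp add: p(1))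
  qed
  finally show ?thesis unfolding W_def .
qed

text \<open>
  The case of order \<open>0\<close> of the moment identity, where no integration in \<open>\<eta>\<close> takes place.  This is where the
  data on the single line \<open>\<eta> = \<gamma>\<close> are used.
\<close>

lemma integral_mass_eq_radon:
  fixes f :: "real \<times> real \<Rightarrow> complex" and w :: "real \<Rightarrow> real"
  assumes f: "continuous_on UNIV f" and par: "\<And>x y. y \<le> x\<^sup>2 \<Longrightarrow> f (x, y) = 0"
    and w: "continuous_on {-\<epsilon>..\<epsilon>} w" and \<gamma>: "0 \<le> \<gamma>" and eg: "\<epsilon> + \<gamma> \<le> 1"
  shows "integral {-1..1} (\<lambda>x. integral {-\<epsilon>..\<epsilon>} (\<lambda>\<xi>. w \<xi> *\<^sub>R f (x, \<gamma> + \<xi> * x)))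
       = integral {-\<epsilon>..\<epsilon>} (\<lambda>\<xi>. w \<xi> *\<^sub>R radon f (\<xi>, \<gamma>))"
proof -
  have "integral (cbox (-1) 1) (\<lambda>x. integral (cbox (-\<epsilon>) \<epsilon>) (\<lambda>\<xi>. w \<xi> *\<^sub>R f (x, \<gamma> + \<xi> * x)))
      = integral (cbox (-\<epsilon>) \<epsilon>) (\<lambda>\<xi>. integral (cbox (-1) 1) (\<lambda>x. w \<xi> *\<^sub>R f (x, \<gamma> + \<xi> * x)))"
    by (intro integral_swap_continuous)
       (auto simp: case_prod_unfold intro!: continuous_on_scaleR continuous_on_compose2[OF w]
          continuous_on_compose2[OF f, of _ "\<lambda>q. (fst q, \<gamma> + snd q * fst q)"] continuous_intros)
  also have "\<dots> = integral (cbox (-\<epsilon>) \<epsilon>) (\<lambda>\<xi>. w \<xi> *\<^sub>R radon f (\<xi>, \<gamma>))"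
  proof (rule integral_cong)
    fix \<xi> assume "\<xi> \<in> cbox (-\<epsilon>) \<epsilon>"
    then have "\<bar>\<xi>\<bar> \<le> \<epsilon>" by auto
    then have "f (x, \<xi> * x + \<gamma>) = 0" if "\<bar>x\<bar> \<ge> 1" for x
      using line_below_parabola_outside_interval[OF that _ order_refl \<gamma> eg] by (intro par) auto
    then show "integral (cbox (-1) 1) (\<lambda>x. w \<xi> *\<^sub>R f (x, \<gamma> + \<xi> * x)) = w \<xi> *\<^sub>R radon f (\<xi>, \<gamma>)"
      using radon_eq_integral[OF f] by (simp add: add.commute)
  qed
  finally show ?thesis by simp
qed


section \<open>The mean as an average over lines\<close>

lemma mean_kernel_deriv_has_derivative:
  assumes "mean_kernel g"
  shows "((deriv ^^ k) g has_real_derivative (deriv ^^ Suc k) g t) (at t)"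
  using assms by (simp add: mean_kernel_def smooth_def field_differentiable_derivI)

text \<open>
  Outside \<open>[-1, 1]\<close> the kernel is locally zero; the end points follow by continuity of the derivative.
\<close>

lemma mean_kernel_deriv_eq_0:
  assumes g: "mean_kernel g" and t: "\<bar>t\<bar> \<ge> 1"
  shows "(deriv ^^ k) g t = 0"
proof -
  define U where "U = {t::real. \<bar>t\<bar> > 1}"
  have oU: "open U" unfolding U_def by (intro open_Collect_less continuous_intros)
  have U: "(deriv ^^ k) g t = 0" if "t \<in> U" for t
    using that
  proof (induction k arbitrary: t)
    case 0
    have "t \<notin> {-1..1}" using 0 by (auto simp: U_def)
    then have "t \<notin> supp g" using g unfolding mean_kernel_def by blast
    then show ?case unfolding supp_def using closure_subset[of "{x. g x \<noteq> 0}"] by auto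
  next
    case (Suc k)
    have "((deriv ^^ k) g has_real_derivative 0) (at t)"
      by (rule has_field_derivative_transform_within_open[OF DERIV_const[of 0] oU Suc.prems])
         (simp add: Suc.IH)
    then show ?case by (simp add: DERIV_imp_deriv)
  qed
  have c: "continuous_on UNIV ((deriv ^^ k) g)"
    using mean_kernel_deriv_has_derivative[OF g]
    by (meson DERIV_isCont continuous_at_imp_continuous_on)
  have "closed {t. (deriv ^^ k) g t = 0}"
    using closed_Collect_eq[OF c continuous_on_const] by simp
  moreover have "{1<..} \<subseteq> {t. (deriv ^^ k) g t = 0}" "{..< -1} \<subseteq> {t. (deriv ^^ k) g t = 0}"
    using U by (auto simp: U_def)
  ultimately have "closure {1::real<..} \<subseteq> {t. (deriv ^^ k) g t = 0}"
    "closure {..< -1::real} \<subseteq> {t. (deriv ^^ k) g t = 0}"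
    by (simp_all only: closure_minimal)
  then show ?thesis using t by (auto simp: abs_if split: if_splits)
qed

text \<open>
  The derivative of order \<open>k\<close> of the averaging density \<open>\<xi> \<mapsto> g(\<xi>/\<epsilon>)/\<epsilon>\<close>.
\<close>

definition scaled_deriv :: "(real \<Rightarrow> real) \<Rightarrow> real \<Rightarrow> nat \<Rightarrow> real \<Rightarrow> real" where
  "scaled_deriv g \<epsilon> k \<xi> = (deriv ^^ k) g (\<xi> / \<epsilon>) / \<epsilon> ^ (k + 1)"

lemma scaled_deriv_has_derivative:
  assumes "mean_kernel g" "0 < \<epsilon>"
  shows "(scaled_deriv g \<epsilon> k has_real_derivative scaled_deriv g \<epsilon> (Suc k) \<xi>) (at \<xi>)"
proof -
  have "((\<lambda>\<xi>. (deriv ^^ k) g (\<xi> / \<epsilon>)) has_real_derivative (deriv ^^ Suc k) g (\<xi> / \<epsilon>) * (1 / \<epsilon>)) (at \<xi>)"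
    using assms(2) by (intro DERIV_chain2[OF mean_kernel_deriv_has_derivative[OF assms(1)]])
      (auto intro!: derivative_eq_intros)
  from DERIV_cdivide[OF this, of "\<epsilon> ^ (k + 1)"] show ?thesis
    by (simp add: scaled_deriv_def[abs_def] mult_ac)
qed

lemma scaled_deriv_eq_0:
  assumes "mean_kernel g" "0 < \<epsilon>" "\<epsilon> \<le> \<bar>\<xi>\<bar>"
  shows "scaled_deriv g \<epsilon> k \<xi> = 0"
  using assms by (simp add: scaled_deriv_def mean_kernel_deriv_eq_0)

lemma scaled_deriv_continuous:
  assumes "mean_kernel g" "0 < \<epsilon>"
  shows "continuous_on S (scaled_deriv g \<epsilon> k)"
  using scaled_deriv_has_derivative[OF assms]
  by (meson DERIV_isCont continuous_at_imp_continuous_on)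

lemma scaled_deriv_0_nonneg: "mean_kernel g \<Longrightarrow> 0 < \<epsilon> \<Longrightarrow> 0 \<le> scaled_deriv g \<epsilon> 0 \<xi>"
  by (simp add: scaled_deriv_def mean_kernel_def)

lemma integral_scaled_deriv_0:
  assumes g: "mean_kernel g" and \<epsilon>: "0 < \<epsilon>"
  shows "integral {-\<epsilon>..\<epsilon>} (scaled_deriv g \<epsilon> 0) = 1"
proof -
  have "1 = (LINT t|lborel. g t)" using g by (simp add: mean_kernel_def)
  also have "\<dots> = \<bar>1 / \<epsilon>\<bar> *\<^sub>R (LINT \<xi>|lborel. g (0 + 1 / \<epsilon> * \<xi>))"
    using \<epsilon> by (intro lborel_integral_real_affine) auto
  also have "\<dots> = (LINT \<xi>|lborel. scaled_deriv g \<epsilon> 0 \<xi>)"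
    using \<epsilon> by (simp add: scaled_deriv_def)
  also have "\<dots> = integral {-\<epsilon>..\<epsilon>} (scaled_deriv g \<epsilon> 0)"
    by (intro lborel_integral_eq_integral_Icc scaled_deriv_continuous scaled_deriv_eq_0 g \<epsilon>)
  finally show ?thesis ..
qed

text \<open>
  Substitute \<open>y = \<gamma> + \<xi> x\<close>.  Evenness of the kernel makes the sign of \<open>x\<close> irrelevant, and the value \<open>f(0, \<gamma>)\<close>
  prescribed at \<open>x = 0\<close> is the one that the formula gives, because the kernel has mass one.
\<close>

lemma mean_eq_integral:
  fixes f :: "real \<times> real \<Rightarrow> complex"
  assumes g: "mean_kernel g" and \<epsilon>: "0 < \<epsilon>" and f: "continuous_on UNIV f"
  shows "mean g \<epsilon> \<gamma> f x = integral {-\<epsilon>..\<epsilon>} (\<lambda>\<xi>. scaled_deriv g \<epsilon> 0 \<xi> *\<^sub>R f (x, \<gamma> + \<xi> * x))"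
proof (cases "x = 0")
  case True
  have "((\<lambda>\<xi>. scaled_deriv g \<epsilon> 0 \<xi> *\<^sub>R f (0, \<gamma>)) has_integral 1 *\<^sub>R f (0, \<gamma>)) {-\<epsilon>..\<epsilon>}"
    using integrable_integral[OF integrable_continuous_real[OF scaled_deriv_continuous[OF g \<epsilon>]]]
    by (intro has_integral_scaleR_left) (metis integral_scaled_deriv_0[OF g \<epsilon>])
  then show ?thesis using True by (simp add: mean_def integral_unique)
next
  case False
  have ev: "g ((\<gamma> - (\<gamma> + x * \<xi>)) / (\<epsilon> * \<bar>x\<bar>)) = g (\<xi> / \<epsilon>)" for \<xi>
  proof (cases "x > 0")
    case True
    then have "(\<gamma> - (\<gamma> + x * \<xi>)) / (\<epsilon> * \<bar>x\<bar>) = - (\<xi> / \<epsilon>)" by simp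
    then show ?thesis using g by (simp only: mean_kernel_def)
  next
    case 2: False
    then have "(\<gamma> - (\<gamma> + x * \<xi>)) / (\<epsilon> * \<bar>x\<bar>) = \<xi> / \<epsilon>" using False by simp
    then show ?thesis by (simp only:)
  qed
  have "mean g \<epsilon> \<gamma> f x
      = (LINT y|lborel. f (x, y) * complex_of_real (g ((\<gamma> - y) / (\<epsilon> * \<bar>x\<bar>)) / (\<epsilon> * \<bar>x\<bar>)))"
    using False by (simp add: mean_def)
  also have "\<dots> = \<bar>x\<bar> *\<^sub>R (LINT \<xi>|lborel. f (x, \<gamma> + x * \<xi>) *
      complex_of_real (g ((\<gamma> - (\<gamma> + x * \<xi>)) / (\<epsilon> * \<bar>x\<bar>)) / (\<epsilon> * \<bar>x\<bar>)))"
    using False by (rule lborel_integral_real_affine)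
  also have "\<dots> = (LINT \<xi>|lborel. \<bar>x\<bar> *\<^sub>R (f (x, \<gamma> + x * \<xi>) *
      complex_of_real (g ((\<gamma> - (\<gamma> + x * \<xi>)) / (\<epsilon> * \<bar>x\<bar>)) / (\<epsilon> * \<bar>x\<bar>))))"
    by (rule Bochner_Integration.integral_scaleR_right[symmetric])
  also have "\<dots> = (LINT \<xi>|lborel. scaled_deriv g \<epsilon> 0 \<xi> *\<^sub>R f (x, \<gamma> + \<xi> * x))"
    unfolding ev using False by (simp add: scaled_deriv_def scaleR_conv_of_real mult_ac)
  also have "\<dots> = integral {-\<epsilon>..\<epsilon>} (\<lambda>\<xi>. scaled_deriv g \<epsilon> 0 \<xi> *\<^sub>R f (x, \<gamma> + \<xi> * x))"
  proof (rule lborel_integral_eq_integral_Icc)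
    show "continuous_on {-\<epsilon>..\<epsilon>} (\<lambda>\<xi>. scaled_deriv g \<epsilon> 0 \<xi> *\<^sub>R f (x, \<gamma> + \<xi> * x))"
      by (intro continuous_on_scaleR scaled_deriv_continuous g \<epsilon> continuous_on_compose2[OF f])
         (auto intro!: continuous_intros)
  qed (simp add: scaled_deriv_eq_0[OF g \<epsilon>])
  finally show ?thesis .
qed

lemma mean_vanishes_outside:
  fixes f :: "real \<times> real \<Rightarrow> complex"
  assumes g: "mean_kernel g" and \<epsilon>: "0 < \<epsilon>" and f: "continuous_on UNIV f"
    and par: "\<And>x y. y \<le> x\<^sup>2 \<Longrightarrow> f (x, y) = 0" and \<gamma>: "0 \<le> \<gamma>" and eg: "\<epsilon> + \<gamma> \<le> 1"
    and x: "\<bar>x\<bar> \<ge> 1"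
  shows "mean g \<epsilon> \<gamma> f x = 0"
proof -
  have "f (x, \<gamma> + \<xi> * x) = 0" if "\<xi> \<in> {-\<epsilon>..\<epsilon>}" for \<xi>
    using line_below_parabola_outside_interval[OF x _ order_refl \<gamma> eg, of \<xi>] that
    by (intro par) (auto simp: add.commute)
  then have "integral {-\<epsilon>..\<epsilon>} (\<lambda>\<xi>. scaled_deriv g \<epsilon> 0 \<xi> *\<^sub>R f (x, \<gamma> + \<xi> * x)) = integral {-\<epsilon>..\<epsilon>} (\<lambda>_. 0)"
    by (intro integral_cong) simp
  then show ?thesis by (simp add: mean_eq_integral[OF g \<epsilon> f])
qed

text \<open>
  Two points over \<open>x\<close> and \<open>y\<close> on a line of slope \<open>|\<xi>| \<le> 1\<close> have distance at most \<open>2 |x - y|\<close>; averaging over \<open>\<xi>\<close>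
  keeps the bound.
\<close>

lemma mean_holder:
  fixes f :: "real \<times> real \<Rightarrow> complex"
  assumes g: "mean_kernel g" and \<epsilon>: "0 < \<epsilon>" "\<epsilon> \<le> 1" and f: "continuous_on UNIV f"
    and hol: "\<And>p q. norm (f p - f q) \<le> C0 * dist p q powr \<alpha>" and \<alpha>: "0 < \<alpha>" "\<alpha> \<le> 1" and C0: "0 \<le> C0"
  shows "norm (mean g \<epsilon> \<gamma> f x - mean g \<epsilon> \<gamma> f y) \<le> 2 * C0 * \<bar>x - y\<bar> powr \<alpha>"
proof -
  let ?w = "scaled_deriv g \<epsilon> 0"
  have c: "continuous_on {-\<epsilon>..\<epsilon>} (\<lambda>\<xi>. f (x, \<gamma> + \<xi> * x))" for x
    by (intro continuous_on_compose2[OF f]) (auto intro!: continuous_intros)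
  have d: "norm (f (x, \<gamma> + \<xi> * x) - f (y, \<gamma> + \<xi> * y)) \<le> 2 * C0 * \<bar>x - y\<bar> powr \<alpha>" if "\<xi> \<in> {-\<epsilon>..\<epsilon>}" for \<xi>
  proof -
    have "dist (x, \<gamma> + \<xi> * x) (y, \<gamma> + \<xi> * y) \<le> \<bar>x - y\<bar> + \<bar>\<xi> * (x - y)\<bar>"
      unfolding dist_prod_def fst_conv snd_conv
      by (rule order_trans[OF sqrt_sum_squares_le_sum_abs]) (simp add: dist_real_def algebra_simps)
    also have "\<bar>\<xi> * (x - y)\<bar> \<le> 1 * \<bar>x - y\<bar>"
      unfolding abs_mult using that \<epsilon> by (intro mult_right_mono) auto
    finally have "dist (x, \<gamma> + \<xi> * x) (y, \<gamma> + \<xi> * y) \<le> 2 * \<bar>x - y\<bar>" by simp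
    then have "dist (x, \<gamma> + \<xi> * x) (y, \<gamma> + \<xi> * y) powr \<alpha> \<le> (2 * \<bar>x - y\<bar>) powr \<alpha>"
      using \<alpha> by (intro powr_mono2) auto
    also have "\<dots> = 2 powr \<alpha> * \<bar>x - y\<bar> powr \<alpha>" by (simp add: powr_mult)
    also have "\<dots> \<le> 2 * \<bar>x - y\<bar> powr \<alpha>"
      using \<alpha> powr_mono[of \<alpha> 1 2] by (intro mult_right_mono) auto
    finally have "C0 * dist (x, \<gamma> + \<xi> * x) (y, \<gamma> + \<xi> * y) powr \<alpha> \<le> C0 * (2 * \<bar>x - y\<bar> powr \<alpha>)"
      using C0 by (rule mult_left_mono)
    then show ?thesis using hol[of "(x, \<gamma> + \<xi> * x)" "(y, \<gamma> + \<xi> * y)"] by simp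
  qed
  have eq: "mean g \<epsilon> \<gamma> f x - mean g \<epsilon> \<gamma> f y
      = integral {-\<epsilon>..\<epsilon>} (\<lambda>\<xi>. ?w \<xi> *\<^sub>R (f (x, \<gamma> + \<xi> * x) - f (y, \<gamma> + \<xi> * y)))"
    unfolding mean_eq_integral[OF g \<epsilon>(1) f] scaleR_diff_right
    by (intro integral_diff[symmetric] integrable_continuous_real continuous_on_scaleR
        scaled_deriv_continuous g \<epsilon> c)
  have le: "norm (integral {-\<epsilon>..\<epsilon>} (\<lambda>\<xi>. ?w \<xi> *\<^sub>R (f (x, \<gamma> + \<xi> * x) - f (y, \<gamma> + \<xi> * y))))
      \<le> integral {-\<epsilon>..\<epsilon>} (\<lambda>\<xi>. ?w \<xi> * (2 * C0 * \<bar>x - y\<bar> powr \<alpha>))"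
  proof (rule integral_norm_bound_integral)
    fix \<xi> assume "\<xi> \<in> {-\<epsilon>..\<epsilon>}"
    from mult_left_mono[OF d[OF this] scaled_deriv_0_nonneg[OF g \<epsilon>(1)]]
    show "norm (?w \<xi> *\<^sub>R (f (x, \<gamma> + \<xi> * x) - f (y, \<gamma> + \<xi> * y))) \<le> ?w \<xi> * (2 * C0 * \<bar>x - y\<bar> powr \<alpha>)"
      using scaled_deriv_0_nonneg[OF g \<epsilon>(1)] by simp
  qed (intro integrable_continuous_real continuous_on_scaleR continuous_on_diff continuous_on_mult
        continuous_on_const scaled_deriv_continuous g \<epsilon> c)+
  have "integral {-\<epsilon>..\<epsilon>} (\<lambda>\<xi>. ?w \<xi> * (2 * C0 * \<bar>x - y\<bar> powr \<alpha>)) = 2 * C0 * \<bar>x - y\<bar> powr \<alpha>"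
    by (subst integral_mult_left) (simp only: integral_scaled_deriv_0[OF g \<epsilon>(1)] mult_1_left)
  then show ?thesis using le unfolding eq by linarith
qed


section \<open>Moment bounds and the choice of the degree\<close>

lemma ennreal_weighted_bound:
  assumes "ennreal n \<le> ennreal W * L" "ennreal c * L \<le> ennreal \<delta>" "0 < c" "0 \<le> W" "0 \<le> \<delta>" "0 \<le> n"
  shows "n \<le> W * (\<delta> / c)"
proof -
  have "ennreal (c * n) = ennreal c * ennreal n" using assms by (intro ennreal_mult) auto
  also have "\<dots> \<le> ennreal c * (ennreal W * L)" using assms by (intro mult_left_mono) auto
  also have "\<dots> = ennreal W * (ennreal c * L)" by (simp add: mult_ac)
  also have "\<dots> \<le> ennreal W * ennreal \<delta>" using assms by (intro mult_left_mono) auto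
  also have "\<dots> = ennreal (W * \<delta>)" using assms by (simp add: ennreal_mult)
  finally have "c * n \<le> W * \<delta>" using assms by (simp add: ennreal_le_iff)
  then show ?thesis using assms by (simp add: field_simps)
qed

text \<open>
  Since \<open>0 \<le> \<gamma> - \<eta> \<le> 2 \<gamma> \<le> 1\<close> on the box, the powers of \<open>\<gamma> - \<eta>\<close> in the weight are at most \<open>1\<close>.
  The truncated difference \<open>k - 1\<close> makes the factorial \<open>1\<close> for \<open>k = 0\<close>, so one formula covers the mass and the
  higher moments.
\<close>

lemma mean_moment_bound:
  fixes f :: "real \<times> real \<Rightarrow> complex"
  assumes g: "mean_kernel g" and \<epsilon>: "0 < \<epsilon>" and f: "continuous_on UNIV f"
    and par: "\<And>x y. y \<le> x\<^sup>2 \<Longrightarrow> f (x, y) = 0" and \<gamma>: "0 \<le> \<gamma>" "2 * \<gamma> \<le> 1"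
    and g4: "\<epsilon>\<^sup>2 / 4 \<le> \<gamma>" and eg: "\<epsilon> + \<gamma> \<le> 1"
    and \<delta>: "0 \<le> \<delta>" and c: "0 < c"
    and data: "ennreal c * max (\<integral>\<^sup>+p\<in>param_box \<epsilon> \<gamma>. ennreal (cmod (radon f p)) \<partial>lborel)
         (\<integral>\<^sup>+\<xi>\<in>{-\<epsilon>..\<epsilon>}. ennreal (cmod (radon f (\<xi>, \<gamma>))) \<partial>lborel) \<le> ennreal \<delta>"
    and B: "\<And>t. \<bar>(deriv ^^ k) g t\<bar> \<le> B"
  shows "norm (integral {-1..1} (\<lambda>x. x ^ k *\<^sub>R mean g \<epsilon> \<gamma> f x))
       \<le> B / \<epsilon> ^ (k + 1) / fact (k - 1) * (\<delta> / c)"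
proof -
  let ?D = "scaled_deriv g \<epsilon>"
  note D = scaled_deriv_has_derivative[OF g \<epsilon>] and D0 = scaled_deriv_eq_0[OF g \<epsilon>]
  note Dc = scaled_deriv_continuous[OF g \<epsilon>]
  have B0: "0 \<le> B" using order_trans[OF abs_ge_zero B] .
  have DB: "\<bar>?D k \<xi>\<bar> \<le> B / \<epsilon> ^ (k + 1)" for \<xi>
    unfolding scaled_deriv_def using \<epsilon> B by (simp add: divide_right_mono)
  have W0: "0 \<le> B / \<epsilon> ^ (k + 1) / fact (k - 1)" using B0 \<epsilon> by simp
  have rad: "continuous_on {p. \<bar>fst p\<bar> \<le> \<epsilon> \<and> snd p \<le> \<gamma>} (radon f)"
  proof -
    have "continuous_on {p. \<bar>fst p\<bar> \<le> \<epsilon> \<and> snd p \<le> \<gamma>}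
        (\<lambda>p. integral (cbox (-1) 1) (\<lambda>x. f (x, fst p * x + snd p)))"
      by (rule integral_continuous_on_param)
         (auto simp: case_prod_unfold intro!: continuous_intros
            continuous_on_compose2[OF f, of _ "\<lambda>q. (snd q, fst (fst q) * snd q + snd (fst q))"])
    moreover have "radon f p = integral (cbox (-1) 1) (\<lambda>x. f (x, fst p * x + snd p))"
      if "\<bar>fst p\<bar> \<le> \<epsilon>" "snd p \<le> \<gamma>" for p
      using radon_eq_integral[OF f, of "fst p" "snd p"]
        line_below_parabola_outside_interval[OF _ that \<gamma>(1) eg] by (simp add: par)
    ultimately show ?thesis by (elim continuous_on_eq) auto
  qed
  show ?thesis
  proof (cases "k = 0")
    case True
    have "continuous_on (cbox (-\<epsilon>) \<epsilon>) (\<lambda>\<xi>. radon f (\<xi>, \<gamma>))"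
      by (rule continuous_on_compose2[OF rad]) (auto intro!: continuous_intros)
    then have "ennreal (norm (integral (cbox (-\<epsilon>) \<epsilon>) (\<lambda>\<xi>. ?D 0 \<xi> *\<^sub>R radon f (\<xi>, \<gamma>))))
        \<le> ennreal (B / \<epsilon> ^ (k + 1) / fact (k - 1)) *
          (\<integral>\<^sup>+\<xi>\<in>{-\<epsilon>..\<epsilon>}. ennreal (cmod (radon f (\<xi>, \<gamma>))) \<partial>lborel)"
      by (rule norm_integral_le_weight_times_L1[OF _ Dc]) (use DB True W0 in auto)
    also have "\<dots> \<le> ennreal (B / \<epsilon> ^ (k + 1) / fact (k - 1)) *
        max (\<integral>\<^sup>+p\<in>param_box \<epsilon> \<gamma>. ennreal (cmod (radon f p)) \<partial>lborel)
         (\<integral>\<^sup>+\<xi>\<in>{-\<epsilon>..\<epsilon>}. ennreal (cmod (radon f (\<xi>, \<gamma>))) \<partial>lborel)"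
      by (intro mult_left_mono) auto
    finally have "norm (integral (cbox (-\<epsilon>) \<epsilon>) (\<lambda>\<xi>. ?D 0 \<xi> *\<^sub>R radon f (\<xi>, \<gamma>)))
        \<le> B / \<epsilon> ^ (k + 1) / fact (k - 1) * (\<delta> / c)"
      by (rule ennreal_weighted_bound[OF _ data c W0 \<delta> norm_ge_zero])
    moreover have "integral {-1..1} (\<lambda>x. mean g \<epsilon> \<gamma> f x) = integral {-\<epsilon>..\<epsilon>} (\<lambda>\<xi>. ?D 0 \<xi> *\<^sub>R radon f (\<xi>, \<gamma>))"
      unfolding mean_eq_integral[OF g \<epsilon> f] by (rule integral_mass_eq_radon[OF f par Dc \<gamma>(1) eg])
    ultimately show ?thesis using True by simp
  next
    case False
    let ?W = "\<lambda>p. (- 1) ^ k * ?D k (fst p) * ((\<gamma> - snd p) ^ (k - 1) / fact (k - 1))"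
    have W: "\<bar>?W p\<bar> \<le> B / \<epsilon> ^ (k + 1) / fact (k - 1)" if "p \<in> cbox (-\<epsilon>, -\<gamma>) (\<epsilon>, \<gamma>)" for p
    proof -
      have "\<bar>\<gamma> - snd p\<bar> \<le> 1" using that \<gamma> by (cases p) auto
      then have "\<bar>\<gamma> - snd p\<bar> ^ (k - 1) / fact (k - 1) \<le> 1 / fact (k - 1)"
        by (intro divide_right_mono power_le_one) auto
      then have "\<bar>?D k (fst p)\<bar> * (\<bar>\<gamma> - snd p\<bar> ^ (k - 1) / fact (k - 1))
          \<le> B / \<epsilon> ^ (k + 1) * (1 / fact (k - 1))"
        using DB B0 \<epsilon> by (intro mult_mono) auto
      then show ?thesis by (simp add: abs_mult power_abs)
    qed
    have "continuous_on (cbox (-\<epsilon>, -\<gamma>) (\<epsilon>, \<gamma>)) ?W"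
      by (intro continuous_intros continuous_on_compose2[OF Dc[of UNIV]]) auto
    moreover have "continuous_on (cbox (-\<epsilon>, -\<gamma>) (\<epsilon>, \<gamma>)) (radon f)"
      by (rule continuous_on_subset[OF rad]) auto
    moreover have "box (-\<epsilon>, -\<gamma>) (\<epsilon>, \<gamma>) \<subseteq> param_box \<epsilon> \<gamma>"
      by (auto simp: param_box_def mem_box Basis_prod_def)
    ultimately have "ennreal (norm (integral (cbox (-\<epsilon>, -\<gamma>) (\<epsilon>, \<gamma>)) (\<lambda>p. ?W p *\<^sub>R radon f p)))
        \<le> ennreal (B / \<epsilon> ^ (k + 1) / fact (k - 1)) *
          (\<integral>\<^sup>+p\<in>param_box \<epsilon> \<gamma>. ennreal (cmod (radon f p)) \<partial>lborel)"
      using W W0 by (intro norm_integral_le_weight_times_L1)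
    also have "\<dots> \<le> ennreal (B / \<epsilon> ^ (k + 1) / fact (k - 1)) *
        max (\<integral>\<^sup>+p\<in>param_box \<epsilon> \<gamma>. ennreal (cmod (radon f p)) \<partial>lborel)
         (\<integral>\<^sup>+\<xi>\<in>{-\<epsilon>..\<epsilon>}. ennreal (cmod (radon f (\<xi>, \<gamma>))) \<partial>lborel)"
      by (intro mult_left_mono) auto
    finally have "norm (integral (cbox (-\<epsilon>, -\<gamma>) (\<epsilon>, \<gamma>)) (\<lambda>p. ?W p *\<^sub>R radon f p))
        \<le> B / \<epsilon> ^ (k + 1) / fact (k - 1) * (\<delta> / c)"
      by (rule ennreal_weighted_bound[OF _ data c W0 \<delta> norm_ge_zero])
    moreover have "integral {-1..1} (\<lambda>x. x ^ k *\<^sub>R mean g \<epsilon> \<gamma> f x)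
        = integral (cbox (-\<epsilon>, -\<gamma>) (\<epsilon>, \<gamma>)) (\<lambda>p. ?W p *\<^sub>R radon f p)"
      unfolding mean_eq_integral[OF g \<epsilon> f]
      by (rule integral_moment_eq_radon[where D = ?D, OF f par D D0 \<epsilon> \<gamma>(1) g4 eg]) (use False in auto)
    ultimately show ?thesis by simp
  qed
qed

text \<open>
  \<open>N\<^sup>k / k!\<close> is a term of the series of \<open>exp N\<close>, the missing factor \<open>k \<le> N\<close> costs another \<open>exp N\<close>, and
  \<open>exp 2 \<le> 9\<close>.
\<close>

lemma power_div_fact_le:
  assumes "k \<le> N" "0 < N"
  shows "real N ^ k / fact (k - 1) \<le> 9 ^ N"
proof (cases k)
  case (Suc j)
  have "real N ^ k / fact k \<le> exp (real N)"
  proof -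
    have "(\<Sum>i\<in>{k}. real N ^ i /\<^sub>R fact i) \<le> (\<Sum>i. real N ^ i /\<^sub>R fact i)"
      by (intro sum_le_suminf summable_exp_generic) auto
    then show ?thesis by (simp add: exp_def divide_inverse mult.commute)
  qed
  moreover have k_le: "real k \<le> exp (real N)"
    using assms exp_ge_add_one_self[of "real N"] by linarith
  ultimately have "real k * (real N ^ k / fact k) \<le> exp (real N) * exp (real N)"
    using k_le by (intro mult_mono) auto
  also have "\<dots> = exp 1 ^ (N + N)" by (simp flip: exp_add exp_of_nat_mult)
  also have "\<dots> \<le> 3 ^ (N + N)" by (intro power_mono exp_le) auto
  also have "\<dots> = (9::real) ^ N" by (simp add: power_add flip: power_mult_distrib)
  finally show ?thesis by (simp add: Suc divide_simps split: if_splits)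
qed simp

text \<open>
  In the base \<open>27 S\<close>, the factor \<open>9\<close> comes from \<open>power_div_fact_le\<close> and \<open>3\<close> from the loss in the Landau smoothing.
\<close>

lemma mean_le_of_derivative_bounds:
  fixes f :: "real \<times> real \<Rightarrow> complex"
  assumes g: "mean_kernel g" and \<epsilon>: "0 < \<epsilon>" "\<epsilon> < 1" and \<alpha>: "0 < \<alpha>" "\<alpha> \<le> 1" and C0: "0 \<le> C0"
    and hol: "\<And>p q. norm (f p - f q) \<le> C0 * dist p q powr \<alpha>"
    and par: "\<And>x y. y \<le> x\<^sup>2 \<Longrightarrow> f (x, y) = 0" and \<gamma>: "0 \<le> \<gamma>" "2 * \<gamma> \<le> 1"
    and g4: "\<epsilon>\<^sup>2 / 4 \<le> \<gamma>" and eg: "\<epsilon> + \<gamma> \<le> 1"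
    and \<delta>: "0 \<le> \<delta>" and c: "0 < c"
    and data: "ennreal c * max (\<integral>\<^sup>+p\<in>param_box \<epsilon> \<gamma>. ennreal (cmod (radon f p)) \<partial>lborel)
         (\<integral>\<^sup>+\<xi>\<in>{-\<epsilon>..\<epsilon>}. ennreal (cmod (radon f (\<xi>, \<gamma>))) \<partial>lborel) \<le> ennreal \<delta>"
    and S: "1 \<le> S" and n: "0 < n"
    and B: "\<And>k t. k \<le> 2 * n \<Longrightarrow> \<bar>(deriv ^^ k) g t\<bar> \<le> S ^ (k + 1) * real (2 * n) ^ k"
    and x: "\<bar>x\<bar> \<le> 1"
  shows "norm (mean g \<epsilon> \<gamma> f x)
       \<le> 6 * C0 * real n powr (-\<alpha>/2) + (27 * S / \<epsilon>) ^ (2 * n + 1) * (\<delta> / c)"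
proof -
  have f: "continuous_on UNIV f" by (rule continuous_if_holder_bound[OF hol \<alpha>(1)])
  note hm = mean_holder[OF g \<epsilon>(1) less_imp_le[OF \<epsilon>(2)] f hol \<alpha> C0, of \<gamma>]
  have cont: "continuous_on UNIV (mean g \<epsilon> \<gamma> f)"
    by (rule continuous_if_holder_bound[where H = "2 * C0" and \<alpha> = \<alpha>])
       (use hm \<alpha> in \<open>auto simp: dist_real_def\<close>)
  let ?\<mu> = "(9 * S / \<epsilon>) ^ (2 * n + 1) * (\<delta> / c)"
  have mom: "norm (integral {-1..1} (\<lambda>x. x ^ k *\<^sub>R mean g \<epsilon> \<gamma> f x)) \<le> ?\<mu>" if k: "k \<le> 2 * n" for k
  proof -
    have "norm (integral {-1..1} (\<lambda>x. x ^ k *\<^sub>R mean g \<epsilon> \<gamma> f x))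
        \<le> S ^ (k + 1) * real (2 * n) ^ k / \<epsilon> ^ (k + 1) / fact (k - 1) * (\<delta> / c)"
      by (rule mean_moment_bound[OF g \<epsilon>(1) f par \<gamma> g4 eg \<delta> c data B[OF k]])
    moreover have "S ^ (k + 1) * real (2 * n) ^ k / \<epsilon> ^ (k + 1) / fact (k - 1) \<le> (9 * S / \<epsilon>) ^ (2 * n + 1)"
    proof -
      have "S ^ (k + 1) * real (2 * n) ^ k / \<epsilon> ^ (k + 1) / fact (k - 1)
          = (S / \<epsilon>) ^ (k + 1) * (real (2 * n) ^ k / fact (k - 1))"
        by (simp add: power_divide)
      also have "\<dots> \<le> (S / \<epsilon>) ^ (2 * n + 1) * 9 ^ (2 * n)"
        using S \<epsilon> k n by (intro mult_mono power_increasing power_div_fact_le) auto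
      also have "\<dots> \<le> (S / \<epsilon>) ^ (2 * n + 1) * 9 ^ (2 * n + 1)"
        using S \<epsilon> by (intro mult_left_mono power_increasing) auto
      also have "\<dots> = (9 * S / \<epsilon>) ^ (2 * n + 1)"
        unfolding power_mult_distrib[symmetric] by (simp add: mult.commute)
      finally show ?thesis .
    qed
    ultimately show ?thesis
      using \<delta> c by (elim order_trans) (intro mult_right_mono, auto)
  qed
  have "norm (mean g \<epsilon> \<gamma> f x) \<le> 3 * (2 * C0) * real n powr (-\<alpha>/2) + 3 ^ n * ?\<mu>"
    by (rule holder_bound_from_moments[OF hm \<alpha>(1) _ n
          mean_vanishes_outside[OF g \<epsilon>(1) f par \<gamma>(1) eg] cont mom x])
       (use \<alpha> in auto)
  also have "3 ^ n * ?\<mu> \<le> 3 ^ (2 * n + 1) * ?\<mu>"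
    using S \<epsilon> \<delta> c by (intro mult_right_mono power_increasing) auto
  also have "\<dots> = (3 * (9 * S / \<epsilon>)) ^ (2 * n + 1) * (\<delta> / c)"
    by (simp only: power_mult_distrib[of 3] mult.assoc)
  finally show ?thesis by simp
qed

text \<open>
  All moments vanish, for a single fixed kernel: with zero data, any finite bound on a derivative will do, of
  whatever order.  Letting the degree of the Landau kernel tend to infinity gives the claim.
\<close>

lemma mean_eq_0_of_zero_data:
  fixes f :: "real \<times> real \<Rightarrow> complex"
  assumes g: "mean_kernel g" and \<epsilon>: "0 < \<epsilon>" "\<epsilon> < 1" and \<alpha>: "0 < \<alpha>" "\<alpha> \<le> 1" and C0: "0 \<le> C0"
    and hol: "\<And>p q. norm (f p - f q) \<le> C0 * dist p q powr \<alpha>"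
    and par: "\<And>x y. y \<le> x\<^sup>2 \<Longrightarrow> f (x, y) = 0" and \<gamma>: "0 \<le> \<gamma>" "2 * \<gamma> \<le> 1"
    and g4: "\<epsilon>\<^sup>2 / 4 \<le> \<gamma>" and eg: "\<epsilon> + \<gamma> \<le> 1" and c: "0 < c"
    and data: "ennreal c * max (\<integral>\<^sup>+p\<in>param_box \<epsilon> \<gamma>. ennreal (cmod (radon f p)) \<partial>lborel)
         (\<integral>\<^sup>+\<xi>\<in>{-\<epsilon>..\<epsilon>}. ennreal (cmod (radon f (\<xi>, \<gamma>))) \<partial>lborel) \<le> ennreal 0"
    and x: "\<bar>x\<bar> \<le> 1"
  shows "mean g \<epsilon> \<gamma> f x = 0"
proof -
  have f: "continuous_on UNIV f" by (rule continuous_if_holder_bound[OF hol \<alpha>(1)])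
  note hm = mean_holder[OF g \<epsilon>(1) less_imp_le[OF \<epsilon>(2)] f hol \<alpha> C0, of \<gamma>]
  have cont: "continuous_on UNIV (mean g \<epsilon> \<gamma> f)"
    by (rule continuous_if_holder_bound[where H = "2 * C0" and \<alpha> = \<alpha>])
       (use hm \<alpha> in \<open>auto simp: dist_real_def\<close>)
  have mom: "norm (integral {-1..1} (\<lambda>x. x ^ k *\<^sub>R mean g \<epsilon> \<gamma> f x)) \<le> 0" for k
  proof -
    have "continuous_on {-1..1} ((deriv ^^ k) g)"
      using mean_kernel_deriv_has_derivative[OF g]
      by (meson DERIV_isCont continuous_at_imp_continuous_on)
    then obtain B where B: "0 \<le> B" "\<And>t. t \<in> {-1..1} \<Longrightarrow> norm ((deriv ^^ k) g t) \<le> B"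
      using continuous_on_compact_bound[OF compact_Icc] by blast
    have "\<bar>(deriv ^^ k) g t\<bar> \<le> B" for t
    proof (cases "\<bar>t\<bar> \<ge> 1")
      case True
      then show ?thesis using mean_kernel_deriv_eq_0[OF g True] B(1) by simp
    next
      case False
      then show ?thesis using B(2)[of t] by (simp add: abs_less_iff not_le)
    qed
    from mean_moment_bound[OF g \<epsilon>(1) f par \<gamma> g4 eg order_refl c data this]
    show ?thesis by simp
  qed
  \<comment> \<open>The moments contribute nothing, so only the smoothing error remains, for every degree.\<close>
  have "norm (mean g \<epsilon> \<gamma> f x) \<le> 6 * C0 * real n powr (-\<alpha>/2)" if "n \<ge> 1" for n
    using holder_bound_from_moments[OF hm \<alpha>(1) _ _
          mean_vanishes_outside[OF g \<epsilon>(1) f par \<gamma>(1) eg] cont mom x, of n] that \<alpha> by simp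
  moreover have "(\<lambda>n. 6 * C0 * real n powr (-\<alpha>/2)) \<longlonglongrightarrow> 6 * C0 * 0"
    using \<alpha> by (intro tendsto_mult_left tendsto_neg_powr filterlim_real_sequentially) auto
  ultimately have "norm (mean g \<epsilon> \<gamma> f x) \<le> 6 * C0 * 0"
    by (intro LIMSEQ_le_const) auto
  then show ?thesis by simp
qed

text \<open>
  With \<open>L = ln(M/\<delta>) / ln(C/\<epsilon>)\<close> and \<open>n\<close> the integer part of \<open>L/8\<close>, the power \<open>2 n + 1 \<le> 4 n \<le> L/2\<close> of \<open>C/\<epsilon>\<close> is at most
  the square root of \<open>M/\<delta>\<close>.  Half of the exponential smallness of \<open>\<delta> = M exp(-L ln(C/\<epsilon>))\<close> is then left over.
  The bound on \<open>\<delta>\<close> means \<open>L > 8\<close>, hence \<open>n \<ge> 1\<close>.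
\<close>

lemma degree_choice:
  fixes M c C \<epsilon> \<delta> \<alpha> \<rho> :: real
  assumes M: "0 < M" and c: "0 < c" and C: "3 \<le> C" and \<epsilon>: "0 < \<epsilon>" "\<epsilon> < 1"
    and \<delta>: "0 < \<delta>" "\<delta> < M * (\<epsilon> / C) ^ 8" and \<alpha>: "\<alpha> \<le> 1" and \<rho>: "0 < \<rho>" "\<rho> \<le> \<alpha> / 2"
  obtains n :: nat where "n \<ge> 1"
    "6 * M * real n powr (-\<alpha>/2) + (C / \<epsilon>) ^ (2 * n + 1) * (\<delta> / c)
      \<le> (24 + 2 / c) * (M * (ln (C / \<epsilon>) / ln (M / \<delta>)) powr \<rho>)"
proof -
  define l where "l = ln (C / \<epsilon>)"
  define L where "L = ln (M / \<delta>) / l"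
  have "C * \<epsilon> \<le> C * 1" using C \<epsilon> by (intro mult_left_mono) auto
  then have Ce: "C / \<epsilon> \<ge> 3" using C \<epsilon> by (simp add: field_simps)
  have expl: "exp l = C / \<epsilon>" unfolding l_def using Ce by (intro exp_ln) linarith
  have l: "l \<ge> 1"
  proof -
    have "exp 1 \<le> exp l" unfolding expl using Ce exp_le by linarith
    then show ?thesis by simp
  qed
  have Ll: "ln (M / \<delta>) = L * l" using l by (simp add: L_def)
  then have \<delta>_eq: "\<delta> = M * exp (- (L * l))"
    using M \<delta> by (simp add: exp_minus flip: Ll)
  have L: "L > 8"
  proof -
    have "(\<epsilon> / C) ^ 8 = exp (- (8 * l))"
      using expl \<epsilon> C by (simp add: exp_minus exp_of_nat_mult[of 8 l, simplified] power_divide)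
    then have "M * exp (- (L * l)) < M * exp (- (8 * l))" using \<delta>(2) \<delta>_eq by simp
    then have "8 * l < L * l" using M by simp
    then show ?thesis using l by simp
  qed
  define n where "n = nat \<lfloor>L / 8\<rfloor>"
  have n1: "n \<ge> 1" unfolding n_def using L by (simp add: le_nat_iff)
  have nL: "real n \<le> L / 8" "L / 8 < real n + 1"
    unfolding n_def using L by linarith+
  \<comment> \<open>\<open>n \<ge> 1\<close> turns \<open>L/8 < n + 1\<close> into \<open>L/8 < 2 n\<close>.\<close>
  have nL16: "L / 16 \<le> real n" using n1 nL by simp
  define R where "R = (1 / L) powr \<rho>"
  have R: "ln (C / \<epsilon>) / ln (M / \<delta>) = 1 / L" using Ll l by (simp add: l_def[symmetric])
  have "real n powr (-\<alpha>/2) \<le> (L / 16) powr (-\<alpha>/2)"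
    using nL16 L \<rho> by (intro powr_mono2') auto
  also have "\<dots> = 16 powr (\<alpha>/2) * L powr (-\<alpha>/2)"
    using L by (simp add: powr_divide powr_minus_divide)
  also have "\<dots> \<le> 16 powr (1/2) * L powr (-\<rho>)"
    using L \<alpha> \<rho> by (intro mult_mono powr_mono) auto
  also have "\<dots> = 4 * R"
    using L by (simp add: R_def powr_half_sqrt powr_divide powr_minus_divide)
  finally have 1: "real n powr (-\<alpha>/2) \<le> 4 * R" .
  have "(C / \<epsilon>) ^ (2 * n + 1) \<le> (C / \<epsilon>) ^ (4 * n)"
    using Ce n1 by (intro power_increasing) auto
  also have "\<dots> = exp (real (4 * n) * l)" unfolding expl[symmetric] by (simp only: exp_of_nat_mult)
  also have "\<dots> \<le> exp (L / 2 * l)"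
    using nL l by (subst exp_le_cancel_iff, intro mult_right_mono) auto
  finally have "(C / \<epsilon>) ^ (2 * n + 1) * \<delta> \<le> exp (L / 2 * l) * \<delta>"
    using \<delta> by (intro mult_right_mono) auto
  also have "\<dots> = M * exp (- (L / 2 * l))"
    by (simp add: \<delta>_eq mult_exp_exp)
  also have "\<dots> \<le> M * exp (- (L / 2))"
    using M L l by (intro mult_left_mono) (auto simp: mult_le_cancel_left1)
  also have "\<dots> \<le> M * (2 * (1 / L))"
  proof -
    have "L / 2 \<le> exp (L / 2)" using exp_ge_add_one_self[of "L / 2"] by linarith
    then have "exp (- (L / 2)) \<le> 2 * (1 / L)"
      using L by (simp add: exp_minus field_simps)
    then show ?thesis using M by (intro mult_left_mono) auto
  qed
  also have "\<dots> \<le> M * (2 * R)"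
  proof -
    have "(1 / L) powr 1 \<le> R" unfolding R_def using L \<alpha> \<rho> by (intro powr_mono') auto
    then show ?thesis using M L by (intro mult_left_mono) auto
  qed
  finally have 2: "(C / \<epsilon>) ^ (2 * n + 1) * (\<delta> / c) \<le> 2 / c * (M * R)"
    using c by (simp add: field_simps)
  have "6 * M * real n powr (-\<alpha>/2) \<le> 24 * (M * R)"
    using mult_left_mono[OF 1, of "6 * M"] M by simp
  with 2 have "6 * M * real n powr (-\<alpha>/2) + (C / \<epsilon>) ^ (2 * n + 1) * (\<delta> / c)
      \<le> (24 + 2 / c) * (M * R)"
    by (simp add: distrib_right)
  then show thesis using n1 that by (simp add: R R_def)
qed

lemma x_pos_le_1_imp:
  assumes "0 < \<gamma>" "\<epsilon> < 1" "x_pos \<epsilon> \<gamma> \<le> 1"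
  shows "\<epsilon> + \<gamma> \<le> 1"
proof -
  have "sqrt (\<epsilon>\<^sup>2 + 4 * \<gamma>) \<le> 2 - \<epsilon>" using assms by (simp add: x_pos_eq)
  then have "\<epsilon>\<^sup>2 + 4 * \<gamma> \<le> (2 - \<epsilon>)\<^sup>2" by (rule sqrt_le_D)
  then show ?thesis by (simp add: power2_eq_square algebra_simps)
qed

lemma data_norms_lower_bound:
  assumes "data_norms nrm"
  obtains c where "0 < c" "\<And>\<epsilon> \<gamma> g. 0 < \<epsilon> \<and> \<epsilon> < 1 \<and> 0 < \<gamma> \<and> \<gamma> \<le> 1 \<Longrightarrow>
      g \<in> borel_measurable borel \<Longrightarrow> ennreal c *
        max (\<integral>\<^sup>+p\<in>param_box \<epsilon> \<gamma>. ennreal (cmod (g p)) \<partial>lborel)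
            (\<integral>\<^sup>+\<xi>\<in>{-\<epsilon>..\<epsilon>}. ennreal (cmod (g (\<xi>, \<gamma>))) \<partial>lborel) \<le> nrm \<epsilon> \<gamma> g"
proof -
  from assms[unfolded data_norms_def, THEN conjunct2, THEN conjunct2]
  obtain c where c: "0 < c \<and> (\<forall>\<epsilon> \<gamma>. 0 < \<epsilon> \<and> \<epsilon> < 1 \<and> 0 < \<gamma> \<and> \<gamma> \<le> 1 \<longrightarrow>
        (\<forall>g\<in>borel_measurable borel. nrm \<epsilon> \<gamma> g \<ge> ennreal c *
              max (\<integral>\<^sup>+p\<in>param_box \<epsilon> \<gamma>. ennreal (cmod (g p)) \<partial>lborel)
                  (\<integral>\<^sup>+\<xi>\<in>{-\<epsilon>..\<epsilon>}. ennreal (cmod (g (\<xi>, \<gamma>))) \<partial>lborel)))" ..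
  show thesis
    by (rule that[OF c[THEN conjunct1]]) (rule c[THEN conjunct2, rule_format])
qed

section \<open>The stability estimate\<close>

theorem theorem3p8:
  fixes \<phi> :: "nat \<Rightarrow> real \<Rightarrow> real"
    and nrm :: "real \<Rightarrow> real \<Rightarrow> (real \<times> real \<Rightarrow> complex) \<Rightarrow> ennreal"
  assumes "test_functions \<phi>" and "data_norms nrm"
  shows "\<exists>C>0. \<exists>M :: real \<Rightarrow> real. (\<forall>C0>0. M C0 > 0) \<and>
    (\<forall>\<alpha> \<rho>. 1/2 < \<alpha> \<and> \<alpha> \<le> 1 \<and> 0 < \<rho> \<and> \<rho> < \<alpha> - 1/2 \<longrightarrow>
      (\<exists>c>0. \<forall>C0>0. \<exists>\<gamma>0>0. \<forall>\<epsilon> \<gamma>.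
        0 < \<epsilon> \<and> \<epsilon> < 1 \<and> 0 < \<gamma> \<and> \<gamma> < \<gamma>0 \<and> \<gamma> \<ge> \<epsilon>\<^sup>2 / 4 \<and> x_pos \<epsilon> \<gamma> \<le> 1 \<longrightarrow>
        \<epsilon> < C \<and>
        (\<exists>\<delta>0>0. \<delta>0 \<le> M C0 \<and>
          (\<forall>f :: real \<times> real \<Rightarrow> complex.
            holder_seminorm \<alpha> f \<le> ennreal C0 \<and> supp f \<subseteq> {(x, y). y \<ge> x\<^sup>2} \<and>
            nrm \<epsilon> \<gamma> (radon f) < ennreal \<delta>0 \<longrightarrow>
            (\<exists>N\<ge>1.
              (SUP x\<in>{-(1/2)..1/2}. ennreal (cmod (mean (\<phi> N) \<epsilon> \<gamma> f x)))
                \<le> (let \<delta> = enn2real (nrm \<epsilon> \<gamma> (radon f)) in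
                    if \<delta> = 0 then 0
                    else ennreal (c * (M C0 * (ln (C / \<epsilon>) / ln (M C0 / \<delta>)) powr \<rho>))))))))"
proof -
  have mk: "mean_kernel (\<phi> N)" if "N \<ge> 1" for N
    using assms(1) that by (simp add: test_functions_def)
  obtain Cs where Cs: "\<And>N k t. N \<ge> 1 \<Longrightarrow> k \<le> N \<Longrightarrow> \<bar>(deriv ^^ k) (\<phi> N) t\<bar> \<le> Cs ^ (k + 1) * real N ^ k"
    using assms(1) unfolding test_functions_def by blast
  define S where "S = max 1 \<bar>Cs\<bar>"
  have S: "1 \<le> S" by (simp add: S_def)
  have SB: "\<bar>(deriv ^^ k) (\<phi> N) t\<bar> \<le> S ^ (k + 1) * real N ^ k" if "N \<ge> 1" "k \<le> N" for N k t
  proof -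
    have "Cs ^ (k + 1) \<le> \<bar>Cs\<bar> ^ (k + 1)" by (metis abs_ge_self power_abs)
    also have "\<dots> \<le> S ^ (k + 1)" by (intro power_mono) (auto simp: S_def)
    finally show ?thesis using Cs[OF that, of t] by (meson mult_right_mono order_trans zero_le_power of_nat_0_le_iff)
  qed
  obtain cn where cn: "cn > 0" and low: "\<And>\<epsilon> \<gamma> g. 0 < \<epsilon> \<and> \<epsilon> < 1 \<and> 0 < \<gamma> \<and> \<gamma> \<le> 1 \<Longrightarrow>
      g \<in> borel_measurable borel \<Longrightarrow> ennreal cn *
        max (\<integral>\<^sup>+p\<in>param_box \<epsilon> \<gamma>. ennreal (cmod (g p)) \<partial>lborel)
            (\<integral>\<^sup>+\<xi>\<in>{-\<epsilon>..\<epsilon>}. ennreal (cmod (g (\<xi>, \<gamma>))) \<partial>lborel) \<le> nrm \<epsilon> \<gamma> g"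
    by (rule data_norms_lower_bound[OF assms(2)]) (rule that)
  define C where "C = 27 * S"
  have C: "C \<ge> 27" using S by (simp add: C_def)
  \<comment> \<open>The estimate for one function, with \<open>M C0 = C0\<close> and the admissible size of the data made explicit.\<close>
  have main: "\<exists>N\<ge>1. (SUP x\<in>{-(1/2)..1/2}. ennreal (cmod (mean (\<phi> N) \<epsilon> \<gamma> f x)))
      \<le> (let \<delta> = enn2real (nrm \<epsilon> \<gamma> (radon f)) in
          if \<delta> = 0 then 0
          else ennreal ((24 + 2 / cn) * (C0 * (ln (C / \<epsilon>) / ln (C0 / \<delta>)) powr \<rho>)))"
    if \<alpha>: "1/2 < \<alpha>" "\<alpha> \<le> 1" and \<rho>: "0 < \<rho>" "\<rho> < \<alpha> - 1/2" and C0: "0 < C0"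
      and \<epsilon>: "0 < \<epsilon>" "\<epsilon> < 1" and \<gamma>: "0 < \<gamma>" "\<gamma> < 1/2" "\<gamma> \<ge> \<epsilon>\<^sup>2 / 4" "x_pos \<epsilon> \<gamma> \<le> 1"
      and f: "holder_seminorm \<alpha> f \<le> ennreal C0" "supp f \<subseteq> {(x, y). y \<ge> x\<^sup>2}"
      and nb: "nrm \<epsilon> \<gamma> (radon f) < ennreal (C0 * (\<epsilon> / C) ^ 8)"
    for \<alpha> \<rho> C0 \<epsilon> \<gamma> and f :: "real \<times> real \<Rightarrow> complex"
  proof -
    define \<delta> where "\<delta> = enn2real (nrm \<epsilon> \<gamma> (radon f))"
    have \<alpha>0: "0 < \<alpha>" using \<alpha> by simp
    have hol: "norm (f p - f q) \<le> C0 * dist p q powr \<alpha>" for p q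
      using holder_seminorm_boundD[OF f(1)] C0 by simp
    note cont = continuous_if_holder_bound[OF hol \<alpha>0]
    note par = vanishes_below_parabola[OF cont f(2)]
    have eg: "\<epsilon> + \<gamma> \<le> 1" by (rule x_pos_le_1_imp[OF \<gamma>(1) \<epsilon>(2) \<gamma>(4)])
    have fin: "nrm \<epsilon> \<gamma> (radon f) = ennreal \<delta>" unfolding \<delta>_def
      using nb by (metis ennreal_enn2real less_top_ennreal order_less_trans ennreal_less_top)
    have \<delta>0: "0 \<le> \<delta>" by (simp add: \<delta>_def)
    have data: "ennreal cn * max (\<integral>\<^sup>+p\<in>param_box \<epsilon> \<gamma>. ennreal (cmod (radon f p)) \<partial>lborel)
         (\<integral>\<^sup>+\<xi>\<in>{-\<epsilon>..\<epsilon>}. ennreal (cmod (radon f (\<xi>, \<gamma>))) \<partial>lborel) \<le> ennreal \<delta>"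
      unfolding fin[symmetric] by (rule low) (use \<epsilon> \<gamma> radon_borel_measurable[OF cont] in auto)
    note cond = \<epsilon> \<alpha>0 \<alpha>(2) less_imp_le[OF C0] hol par less_imp_le[OF \<gamma>(1)] _ \<gamma>(3) eg
    have \<gamma>2: "2 * \<gamma> \<le> 1" using \<gamma> by simp
    show ?thesis
    proof (cases "\<delta> = 0")
      case True
      have "mean (\<phi> 1) \<epsilon> \<gamma> f x = 0" if "x \<in> {-(1/2)..1/2}" for x
        by (rule mean_eq_0_of_zero_data[OF mk cond cn data[unfolded True]])
           (use that \<gamma>2 in auto)
      then have "(SUP x\<in>{-(1/2)..1/2}. ennreal (cmod (mean (\<phi> 1) \<epsilon> \<gamma> f x))) \<le> 0"
        by (intro SUP_least) simp
      then show ?thesis using True by (intro exI[of _ 1]) (simp add: \<delta>_def)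
    next
      case False
      then have "0 < \<delta>" using \<delta>0 by simp
      moreover have "\<delta> < C0 * (\<epsilon> / C) ^ 8"
        using nb unfolding fin using \<delta>0 by (simp add: ennreal_less_iff)
      ultimately obtain n where n: "n \<ge> 1" and le:
        "6 * C0 * real n powr (-\<alpha>/2) + (C / \<epsilon>) ^ (2 * n + 1) * (\<delta> / cn)
          \<le> (24 + 2 / cn) * (C0 * (ln (C / \<epsilon>) / ln (C0 / \<delta>)) powr \<rho>)"
        using degree_choice[OF C0 cn _ \<epsilon> _ _ \<alpha>(2) \<rho>(1), of C \<delta>] C \<alpha> \<rho> by auto
      have "ennreal (cmod (mean (\<phi> (2 * n)) \<epsilon> \<gamma> f x))
          \<le> ennreal ((24 + 2 / cn) * (C0 * (ln (C / \<epsilon>) / ln (C0 / \<delta>)) powr \<rho>))"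
        if "x \<in> {-(1/2)..1/2}" for x
      proof (rule ennreal_leI, rule order_trans[OF _ le], unfold C_def)
        show "cmod (mean (\<phi> (2 * n)) \<epsilon> \<gamma> f x)
            \<le> 6 * C0 * real n powr (-\<alpha>/2) + (27 * S / \<epsilon>) ^ (2 * n + 1) * (\<delta> / cn)"
          by (rule mean_le_of_derivative_bounds[OF mk cond \<delta>0 cn data S _ SB])
             (use that n \<gamma>2 in auto)
      qed
      then have "(SUP x\<in>{-(1/2)..1/2}. ennreal (cmod (mean (\<phi> (2 * n)) \<epsilon> \<gamma> f x)))
          \<le> ennreal ((24 + 2 / cn) * (C0 * (ln (C / \<epsilon>) / ln (C0 / \<delta>)) powr \<rho>))"
        by (rule SUP_least)
      then show ?thesis using n False
        by (intro exI[of _ "2 * n"]) (simp add: Let_def \<delta>_def[symmetric])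
    qed
  qed
  have thr: "0 < C0 * (\<epsilon> / C) ^ 8 \<and> C0 * (\<epsilon> / C) ^ 8 \<le> C0" if "0 < C0" "0 < \<epsilon>" "\<epsilon> < 1" for C0 \<epsilon>
  proof -
    have "(\<epsilon> / C) ^ 8 \<le> 1" using that C by (intro power_le_one) (auto simp: field_simps)
    then show ?thesis using that C by (simp add: mult_left_le)
  qed
  \<comment> \<open>The thresholds: \<open>\<gamma> < 1/2\<close> keeps the offsets within distance one, and \<open>C0 (\<epsilon>/C) ^ 8\<close> is the bound on the data
    that \<open>degree_choice\<close> asks for.\<close>
  have fin: "\<epsilon> < C \<and> (\<exists>\<delta>0>0. \<delta>0 \<le> C0 \<and>
        (\<forall>f :: real \<times> real \<Rightarrow> complex.
          holder_seminorm \<alpha> f \<le> ennreal C0 \<and> supp f \<subseteq> {(x, y). y \<ge> x\<^sup>2} \<and>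
          nrm \<epsilon> \<gamma> (radon f) < ennreal \<delta>0 \<longrightarrow>
          (\<exists>N\<ge>1.
            (SUP x\<in>{-(1/2)..1/2}. ennreal (cmod (mean (\<phi> N) \<epsilon> \<gamma> f x)))
              \<le> (let \<delta> = enn2real (nrm \<epsilon> \<gamma> (radon f)) in
                  if \<delta> = 0 then 0
                  else ennreal ((24 + 2 / cn) * (C0 * (ln (C / \<epsilon>) / ln (C0 / \<delta>)) powr \<rho>))))))"
    if ar: "1/2 < \<alpha>" "\<alpha> \<le> 1" "0 < \<rho>" "\<rho> < \<alpha> - 1/2"
      and eg: "0 < C0" "0 < \<epsilon>" "\<epsilon> < 1" "0 < \<gamma>" "\<gamma> < 1/2" "\<gamma> \<ge> \<epsilon>\<^sup>2 / 4" "x_pos \<epsilon> \<gamma> \<le> 1"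
    for \<alpha> \<rho> C0 \<epsilon> \<gamma>
  proof (intro conjI exI[of _ "C0 * (\<epsilon> / C) ^ 8"] allI impI)
    show "\<epsilon> < C" using C eg by linarith
    show "0 < C0 * (\<epsilon> / C) ^ 8" "C0 * (\<epsilon> / C) ^ 8 \<le> C0" using thr[OF eg(1-3)] by auto
  qed (elim conjE, rule main[OF ar eg])
  have c0: "0 < 24 + 2 / cn" using cn by (simp add: add_pos_pos)
  show ?thesis
  proof (rule exI[of _ C], rule conjI)
    show "0 < C" using C by simp
  qed (rule exI[of _ "\<lambda>C0. C0"], rule conjI, simp, intro allI impI, elim conjE,
       rule exI[of _ "24 + 2 / cn"], rule conjI, rule c0, intro allI impI,
       rule exI[of _ "1/2"], rule conjI, simp, intro allI impI, elim conjE, rule fin)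
qed

end
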